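(* For every $\beta\in(\gamma_0,\infty)$, $$\tilde t(\beta)=\frac{P(-\hat q(\beta))}\beta-\hat q(\beta)=\frac1\beta\inf_{q<-1/2}\{P(-q)-q\beta\},$$ where $\hat q(\beta)<-1/2$ is the solution $q$ of $\frac{d}{dq}\big[P(-q)\big]=\beta$.
   Context: $\gamma_0=2\log\frac{1+\sqrt5}2$. Write $[\omega_1,\dots,\omega_n+x]=\cfrac{1}{\omega_1+\cfrac{1}{\ddots+\cfrac{1}{\omega_n+x}}}$. For $s>1/2$, $$P(s)=\lim_{n\to\infty}\frac1n\log\sum_{\omega_1=1}^\infty\cdots\sum_{\omega_n=1}^\infty\exp\Big(\sup_{x\in[0,1]}\log\prod_{j=1}^n([\omega_j,\dots,\omega_n+x])^{2s}\Big),$$ a real-analytic function on $(1/2,\infty)$, and $P_1(\tilde t,q)=P(\tilde t-q)$ for $\tilde t-q>1/2$. For $\beta\in(\gamma_0,\infty)$, $\tilde t(\beta)$ is the first coordinate of the unique solution $(\tilde t,q)$ in $\tilde D_0=\{(\tilde t,q)\in\mathbb{R}^2:\tilde t-q>1/2,\ 0\le\tilde t\le1\}$ of the system $P_1(\tilde t,q)=q\beta$, $\frac{\partial P_1}{\partial q}(\tilde t,q)=\beta$. *)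

theory Defs
  imports "HOL-Analysis.Analysis"
begin

definition \<gamma>\<^sub>0 :: real where
  "\<gamma>\<^sub>0 = 2 * ln ((1 + sqrt 5) / 2)"

text \<open>\<open>cf [\<omega>\<^sub>1, \<dots>, \<omega>\<^sub>n] x\<close> is the continued fraction \<open>[\<omega>\<^sub>1, \<dots>, \<omega>\<^sub>n + x]\<close>.\<close>

fun cf :: "nat list \<Rightarrow> real \<Rightarrow> real" where
  "cf [] x = x"
| "cf (a # \<omega>) x = 1 / (real a + cf \<omega> x)"

definition words :: "nat \<Rightarrow> nat list set" where
  "words n = {\<omega>. length \<omega> = n \<and> set \<omega> \<subseteq> {1..}}"

text \<open>The \<open>n\<close>-fold sum over \<open>\<omega>\<^sub>1, \<dots>, \<omega>\<^sub>n \<ge> 1\<close> is a sum over words of length \<open>n\<close> (all terms are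
  positive). The index \<open>j\<close> starts at \<open>0\<close>, so \<open>drop j \<omega>\<close> is \<open>[\<omega>\<^sub>j\<^sub>+\<^sub>1, \<dots>, \<omega>\<^sub>n]\<close>.
  The value is only meaningful for \<open>s > 1/2\<close>.\<close>

definition pressure :: "real \<Rightarrow> real" where
  "pressure s = lim (\<lambda>n. 1 / real n * ln (\<Sum>\<^sub>\<infinity>\<omega>\<in>words n.
     exp (SUP x\<in>{0..1}. ln (\<Prod>j<n. cf (drop j \<omega>) x powr (2 * s)))))"

definition pressure1 :: "real \<Rightarrow> real \<Rightarrow> real" where
  "pressure1 t q = pressure (t - q)"

definition D0 :: "(real \<times> real) set" where
  "D0 = {(t, q). t - q > 1/2 \<and> 0 \<le> t \<and> t \<le> 1}"

definition t_tilde :: "real \<Rightarrow> real" where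
  "t_tilde \<beta> = fst (THE (t, q). (t, q) \<in> D0 \<and> pressure1 t q = q * \<beta> \<and>
     ((\<lambda>q'. pressure1 t q') has_real_derivative \<beta>) (at q))"

definition solves_q_hat :: "real \<Rightarrow> real \<Rightarrow> bool" where
  "solves_q_hat \<beta> q \<longleftrightarrow> q < -1/2 \<and> ((\<lambda>q'. pressure (- q')) has_real_derivative \<beta>) (at q)"

definition q_hat :: "real \<Rightarrow> real" where
  "q_hat \<beta> = (THE q. solves_q_hat \<beta> q)"

end

theory Submission
  imports Defs "HOL-Complex_Analysis.Great_Picard"
begin

text \<open>
  With \<open>L\<^sub>s f x = \<Sum>\<^sub>a (a + x)\<^sup>-\<^sup>2\<^sup>s f (1 / (a + x))\<close> the \<open>n\<close>-fold sum defining the pressure is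
  \<open>L\<^sub>s\<^sup>n 1\<close> at \<open>0\<close>, and bounded distortion makes it multiplicative up to a constant, so the limit
  \<open>P s\<close> exists and \<open>L\<^sub>s f \<le> \<mu> f\<close> with \<open>f > 0\<close> implies \<open>P s \<le> ln \<mu>\<close>. Cesaro means and
  Arzela-Ascoli give a positive eigenfunction \<open>h\<^sub>s\<close> for \<open>exp (P s)\<close>.

  Everything about \<open>P\<close> then follows from test functions. The geometric mean of \<open>h\<^sub>s\<close> and \<open>h\<^sub>u\<close> gives
  strict midpoint convexity. A perturbation \<open>h\<^sub>s - t k\<close>, where \<open>k\<close> approximately solves the Poisson
  equation for the derivative of the weights, gives \<open>P (s + t) \<le> P s + t d + o(t)\<close>, which together
  with convexity is differentiability. The function \<open>1 / (1 + x)\<close> gives \<open>P 1 \<le> 0\<close>. Finally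
  \<open>P s + s \<beta>\<close> is nonnegative, blows up at \<open>1/2\<close> and at \<open>\<infinity>\<close>, and its unique critical point \<open>s\<^sub>0\<close>
  is its minimum; \<open>q = - s\<^sub>0\<close> and \<open>t = (P s\<^sub>0 + s\<^sub>0 \<beta>) / \<beta>\<close> solve both systems.
\<close>

section \<open>Continued fraction branches\<close>

lemma inverse_add_unit:
  assumes "x \<in> {0..1}" "a \<ge> (1::nat)"
  shows "1 / (real a + x) \<in> {0<..1}" "1 / (real a + x) \<in> {0..1}"
  using assms by (auto simp: field_simps)

lemma inverse_add_lipschitz:
  assumes "x \<in> {0..1}" "y \<in> {0..1}" "a \<ge> (1::nat)"
  shows "\<bar>1 / (real a + x) - 1 / (real a + y)\<bar> \<le> \<bar>x - y\<bar>"
proof -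
  have "1 \<le> (real a + x) * (real a + y)"
    using assms mult_mono[of 1 "real a + x" 1 "real a + y"] by auto
  moreover have "1 / (real a + x) - 1 / (real a + y) = (y - x) / ((real a + x) * (real a + y))"
    using assms by (auto simp: divide_simps)
  ultimately show ?thesis
    using mult_left_mono[of 1 "(real a + x) * (real a + y)" "\<bar>y - x\<bar>"]
    by (simp add: abs_divide divide_le_eq abs_minus_commute)
qed

lemma cf_unit: "set \<omega> \<subseteq> {1..} \<Longrightarrow> x \<in> {0..1} \<Longrightarrow> cf \<omega> x \<in> {0..1}"
  by (induction \<omega>) (use inverse_add_unit in auto)

lemma cf_lipschitz:
  "set \<omega> \<subseteq> {1..} \<Longrightarrow> x \<in> {0..1} \<Longrightarrow> y \<in> {0..1} \<Longrightarrow> \<bar>cf \<omega> x - cf \<omega> y\<bar> \<le> \<bar>x - y\<bar>"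
proof (induction \<omega>)
  case (Cons a \<omega>)
  then have "\<bar>cf (a # \<omega>) x - cf (a # \<omega>) y\<bar> \<le> \<bar>cf \<omega> x - cf \<omega> y\<bar>"
    using inverse_add_lipschitz[of "cf \<omega> x" "cf \<omega> y" a] cf_unit[of \<omega> x] cf_unit[of \<omega> y] by simp
  then show ?case using Cons by simp
qed simp

text \<open>By the chain rule for \<open>1 / (a + x)\<close> this is the square root of the absolute
  derivative of the branch \<open>cf \<omega>\<close> at \<open>x\<close>; its power
  \<open>2 * s\<close> is the summand in the pressure.\<close>

definition weight :: "nat list \<Rightarrow> real \<Rightarrow> real" where
  "weight \<omega> x = (\<Prod>j<length \<omega>. cf (drop j \<omega>) x)"

lemma weight_Nil [simp]: "weight [] x = 1"
  by (simp add: weight_def)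

lemma weight_Cons: "weight (a # \<omega>) x = cf (a # \<omega>) x * weight \<omega> x"
  unfolding weight_def by (simp add: prod.lessThan_Suc_shift del: prod.lessThan_Suc)

text \<open>The denominators are \<open>q\<^sub>n + x q\<^sub>n\<^sub>-\<^sub>1\<close>; the inequality between \<open>p + q\<close> and \<open>p' + q'\<close> makes
  the induction go through.\<close>

lemma weight_moebius:
  assumes "set \<omega> \<subseteq> {1..}"
  shows "\<exists>p p' q q'. 0 \<le> p \<and> 0 \<le> p' \<and> 0 < q \<and> 0 \<le> q' \<and> q' \<le> q \<and> q' + p' \<le> q + p \<and>
    (\<forall>x\<in>{0..1}. cf \<omega> x = (p + p' * x) / (q + q' * x) \<and> weight \<omega> x = 1 / (q + q' * x))"
  using assms
proof (induction \<omega>)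
  case Nil
  show ?case
    by (rule exI[of _ 0], rule exI[of _ 1], rule exI[of _ 1], rule exI[of _ 0]) simp
next
  case (Cons a \<omega>)
  then obtain p p' q q' where H: "0 \<le> p" "0 \<le> p'" "0 < q" "0 \<le> q'" "q' \<le> q" "q' + p' \<le> q + p"
    and E: "\<And>x. x \<in> {0..1} \<Longrightarrow> cf \<omega> x = (p + p' * x) / (q + q' * x)"
      "\<And>x. x \<in> {0..1} \<Longrightarrow> weight \<omega> x = 1 / (q + q' * x)"
    by auto
  have a: "1 \<le> real a" using Cons.prems by auto
  have le: "a * q' + p' \<le> a * q + p"
  proof -
    \<comment> \<open>\<open>a * q + p\<close> is \<open>(a - 1) * q\<close> plus
      \<open>q + p\<close>, and both parts dominate their primed counterparts.\<close>
    have "(real a - 1) * q' \<le> (real a - 1) * q" using a H by (intro mult_left_mono) auto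
    then show ?thesis using H by (simp add: algebra_simps)
  qed
  have pos: "0 < a * q + p" using a H by (simp add: add_pos_nonneg)
  have "cf (a # \<omega>) x = (q + q' * x) / ((a * q + p) + (a * q' + p') * x) \<and>
      weight (a # \<omega>) x = 1 / ((a * q + p) + (a * q' + p') * x)" if x: "x \<in> {0..1}" for x
  proof -
    have d: "0 < q + q' * x" using H x by (simp add: add_pos_nonneg)
    have "0 \<le> (a * q' + p') * x" using H x by simp
    then have d': "0 < (a * q + p) + (a * q' + p') * x" using pos by linarith
    have "real a + cf \<omega> x = ((a * q + p) + (a * q' + p') * x) / (q + q' * x)"
      using d E(1)[OF x] by (simp add: field_simps)
    then have 1: "cf (a # \<omega>) x = (q + q' * x) / ((a * q + p) + (a * q' + p') * x)" by simp
    then show ?thesis unfolding weight_Cons E(2)[OF x] using d d' by simp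
  qed
  then show ?case using H le pos
    by (intro exI[of _ q] exI[of _ q'] exI[of _ "a * q + p"] exI[of _ "a * q' + p'"]) auto
qed

text \<open>The weight is the reciprocal of a denominator \<open>q + q' * x\<close> that does not
  decrease in \<open>x\<close>. That the maximum sits at \<open>0\<close> makes the supremum in
  \<open>pressure\<close> explicit.\<close>

lemma weight_bounds:
  assumes "set \<omega> \<subseteq> {1..}" "x \<in> {0..1}"
  shows "0 < weight \<omega> x" "weight \<omega> x \<le> weight \<omega> 0"
proof -
  obtain q q' where H: "0 < q" "0 \<le> q'"
    and E: "\<And>x. x \<in> {0..1} \<Longrightarrow> weight \<omega> x = 1 / (q + q' * x)"
    using weight_moebius[OF assms(1)] by metis
  have "0 \<le> q' * x" using H assms by simp
  then show "0 < weight \<omega> x" "weight \<omega> x \<le> weight \<omega> 0"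
    using E[OF assms(2)] E[of 0] H by (simp_all add: frac_le)
qed

text \<open>Bounded distortion: \<open>q' \<le> q\<close> keeps the logarithmic derivative of
  \<open>q + q' * x\<close> at most \<open>1\<close>, for words of every length.\<close>

lemma weight_log_lipschitz:
  assumes "set \<omega> \<subseteq> {1..}" "x \<in> {0..1}" "y \<in> {0..1}"
  shows "weight \<omega> x \<le> exp \<bar>x - y\<bar> * weight \<omega> y"
proof -
  obtain q q' where H: "0 < q" "0 \<le> q'" "q' \<le> q"
    and E: "weight \<omega> x = 1 / (q + q' * x)" "weight \<omega> y = 1 / (q + q' * y)"
    using weight_moebius[OF assms(1)] assms(2,3) by metis
  have d: "0 < q + q' * x" "0 < q + q' * y" using H assms by (auto simp: add_pos_nonneg)
  have "q' * (y - x) \<le> q' * \<bar>x - y\<bar>" using H by (intro mult_left_mono) auto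
  also have "\<dots> \<le> (q + q' * x) * \<bar>x - y\<bar>"
  proof (rule mult_right_mono)
    have "0 \<le> q' * x" using H assms by simp
    then show "q' \<le> q + q' * x" using H by linarith
  qed simp
  finally have "q + q' * y \<le> (q + q' * x) * (1 + \<bar>x - y\<bar>)" by (simp add: algebra_simps)
  also have "\<dots> \<le> (q + q' * x) * exp \<bar>x - y\<bar>"
    using d exp_ge_add_one_self[of "\<bar>x - y\<bar>"] by (intro mult_left_mono) auto
  finally show ?thesis using d unfolding E by (simp add: field_simps)
qed

lemma pressure_summand:
  assumes "\<omega> \<in> words n" "s > 0"
  shows "exp (SUP x\<in>{0..1}. ln (\<Prod>j<n. cf (drop j \<omega>) x powr (2 * s))) = weight \<omega> 0 powr (2 * s)"
proof -
  have \<omega>: "set \<omega> \<subseteq> {1..}" "length \<omega> = n" using assms by (auto simp: words_def)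
  have eq: "(\<Prod>j<n. cf (drop j \<omega>) x powr (2 * s)) = weight \<omega> x powr (2 * s)" if "x \<in> {0..1}" for x
  proof -
    have "set (drop j \<omega>) \<subseteq> {1..}" for j using \<omega>(1) set_drop_subset[of j \<omega>] by auto
    then have "0 \<le> cf (drop j \<omega>) x" for j using cf_unit[of "drop j \<omega>" x] that by auto
    then show ?thesis unfolding weight_def using \<omega>(2) prod_powr_distrib by metis
  qed
  have "(SUP x\<in>{0..1}. ln (\<Prod>j<n. cf (drop j \<omega>) x powr (2 * s)))
      = (SUP x\<in>{0..1}. ln (weight \<omega> x powr (2 * s)))"
    by (rule SUP_cong) (use eq in auto)
  also have "\<dots> = ln (weight \<omega> 0 powr (2 * s))"
  proof (rule cSup_eq_maximum)
    fix z assume "z \<in> (\<lambda>x. ln (weight \<omega> x powr (2 * s))) ` {0..1}"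
    then obtain x where x: "x \<in> {0..1}" "z = ln (weight \<omega> x powr (2 * s))" by auto
    show "z \<le> ln (weight \<omega> 0 powr (2 * s))"
      using weight_bounds(1)[OF \<omega>(1) x(1)] weight_bounds(2)[OF \<omega>(1) x(1)] assms(2)
      by (simp add: x(2) powr_mono2)
  qed auto
  finally show ?thesis using weight_bounds(1)[OF \<omega>(1), of 0] by (simp add: powr_def)
qed

section \<open>The transfer operator\<close>

text \<open>The Ruelle-Mayer transfer operator of the Gauss map. Since \<open>infsum\<close> gives a
  family that is not summable the default value \<open>0\<close>, summability is tracked separately
  by \<open>admissible\<close>.\<close>

definition transfer :: "real \<Rightarrow> (real \<Rightarrow> real) \<Rightarrow> real \<Rightarrow> real" where
  "transfer s f x = (\<Sum>\<^sub>\<infinity>a\<in>{1..}. (1 / (real a + x)) powr (2 * s) * f (1 / (real a + x)))"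

definition admissible :: "real \<Rightarrow> (real \<Rightarrow> real) \<Rightarrow> bool" where
  "admissible s f \<longleftrightarrow>
     (\<forall>x\<in>{0..1}. (\<lambda>a::nat. (1 / (real a + x)) powr (2 * s) * f (1 / (real a + x))) summable_on {1..})"

lemma transfer_has_sum:
  assumes "admissible s f" "x \<in> {0..1}"
  shows "((\<lambda>a::nat. (1 / (real a + x)) powr (2 * s) * f (1 / (real a + x))) has_sum transfer s f x) {1..}"
  using assms unfolding admissible_def transfer_def by simp

lemma transfer_eqI:
  assumes "((\<lambda>a::nat. (1 / (real a + x)) powr (2 * s) * f (1 / (real a + x))) has_sum z) {1..}"
  shows "transfer s f x = z"
  using assms unfolding transfer_def by (rule infsumI)

lemma admissible_const:
  assumes "s > 1/2"
  shows "admissible s (\<lambda>_. 1)"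
  unfolding admissible_def
proof
  fix x :: real assume x: "x \<in> {0..1}"
  have "summable (\<lambda>a. real a powr - (2 * s))" using assms by (simp add: summable_real_powr_iff)
  then have "(\<lambda>a. real a powr - (2 * s)) summable_on UNIV"
    by (intro summable_nonneg_imp_summable_on) auto
  then have "(\<lambda>a. real a powr - (2 * s)) summable_on {1..}" by (rule summable_on_subset_banach) simp
  then show "(\<lambda>a::nat. (1 / (real a + x)) powr (2 * s) * 1) summable_on {1..}"
  proof (rule summable_on_comparison_test)
    fix a :: nat assume "a \<in> {1..}"
    then have "(1 / (real a + x)) powr (2 * s) \<le> (1 / real a) powr (2 * s)"
      using x assms by (intro powr_mono2) (auto simp: field_simps)
    then show "(1 / (real a + x)) powr (2 * s) * 1 \<le> real a powr - (2 * s)"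
      by (simp add: powr_minus powr_divide divide_simps)
  qed auto
qed

lemma admissible_add:
  assumes "admissible s f" "admissible s g"
  shows "admissible s (\<lambda>x. f x + g x)"
  using assms unfolding admissible_def by (auto simp: distrib_left intro: summable_on_add)

lemma admissible_cmult:
  assumes "admissible s f"
  shows "admissible s (\<lambda>x. c * f x)"
  using assms unfolding admissible_def mult.left_commute[of _ c] by (auto intro: summable_on_cmult_right)

text \<open>The branches never take the value \<open>0\<close>, so a bound on \<open>{0<..1}\<close>
  suffices; dominating functions may blow up at \<open>0\<close>, as negative powers do.\<close>

lemma admissible_comparison:
  assumes "admissible s f" "\<And>y. y \<in> {0<..1} \<Longrightarrow> \<bar>g y\<bar> \<le> f y"
  shows "admissible s g"
  unfolding admissible_def
proof
  fix x :: real assume x: "x \<in> {0..1}"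
  let ?t = "\<lambda>f a. (1 / (real a + x)) powr (2 * s) * f (1 / (real a + x))"
  have "(\<lambda>a. \<bar>?t g a\<bar>) summable_on {1..}"
  proof (rule summable_on_comparison_test)
    show "?t f summable_on {1..}" using assms(1) x unfolding admissible_def by blast
    show "\<bar>?t g a\<bar> \<le> ?t f a" if "a \<in> {1..}" for a
      using assms(2)[OF inverse_add_unit(1)[OF x, of a]] that
      by (auto simp: abs_mult intro!: mult_left_mono)
  qed auto
  then show "?t g summable_on {1..}" using abs_summable_summable[of "?t g"] by simp
qed

lemma admissible_bounded:
  assumes "s > 1/2" "\<And>y. y \<in> {0..1} \<Longrightarrow> \<bar>g y\<bar> \<le> C"
  shows "admissible s g"
  using admissible_comparison[OF admissible_cmult[OF admissible_const[OF assms(1)], of C]] assms(2)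
  by auto

lemma transfer_add:
  assumes "admissible s f" "admissible s g" "x \<in> {0..1}"
  shows "transfer s (\<lambda>y. f y + g y) x = transfer s f x + transfer s g x"
  by (rule transfer_eqI)
    (use has_sum_add[OF transfer_has_sum[OF assms(1,3)] transfer_has_sum[OF assms(2,3)]]
      in \<open>simp add: distrib_left\<close>)

lemma transfer_cmult: "transfer s (\<lambda>y. c * f y) x = c * transfer s f x"
  unfolding transfer_def by (simp add: mult.left_commute infsum_cmult_right')

lemma transfer_diff:
  assumes "admissible s f" "admissible s g" "x \<in> {0..1}"
  shows "transfer s (\<lambda>y. f y - g y) x = transfer s f x - transfer s g x"
  using transfer_add[OF assms(1) admissible_cmult[OF assms(2), of "-1"] assms(3)]
    transfer_cmult[of s "-1" g x] by simp

lemma transfer_mono: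
  assumes "admissible s f" "admissible s g" "x \<in> {0..1}" "\<And>y. y \<in> {0<..1} \<Longrightarrow> f y \<le> g y"
  shows "transfer s f x \<le> transfer s g x"
proof (rule has_sum_mono[OF transfer_has_sum[OF assms(1,3)] transfer_has_sum[OF assms(2,3)]])
  fix a :: nat assume "a \<in> {1..}"
  then show "(1 / (real a + x)) powr (2 * s) * f (1 / (real a + x))
      \<le> (1 / (real a + x)) powr (2 * s) * g (1 / (real a + x))"
    using assms(4)[OF inverse_add_unit(1)[OF assms(3), of a]] by (auto intro: mult_left_mono)
qed

lemma transfer_cong:
  assumes "\<And>y. y \<in> {0<..1} \<Longrightarrow> f y = g y" "x \<in> {0..1}"
  shows "transfer s f x = transfer s g x"
  unfolding transfer_def using assms(1)[OF inverse_add_unit(1)[OF assms(2)]]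
  by (intro infsum_cong) auto

lemma transfer_nonneg:
  assumes "\<And>y. y \<in> {0<..1} \<Longrightarrow> 0 \<le> f y" "x \<in> {0..1}"
  shows "0 \<le> transfer s f x"
  unfolding transfer_def using assms(1)[OF inverse_add_unit(1)[OF assms(2)]]
  by (intro infsum_nonneg) auto

text \<open>A change of exponent becomes a multiplier on the function, so operators for nearby
  exponents can be compared inside one \<open>transfer s\<close>.\<close>

lemma transfer_shift:
  assumes "x \<in> {0..1}"
  shows "transfer (s + t) f x = transfer s (\<lambda>y. y powr (2 * t) * f y) x"
  unfolding transfer_def by (intro infsum_cong) (simp add: powr_add distrib_left mult.assoc)

lemma transfer_one_bounds:
  assumes "s > 1/2" "x \<in> {0..1}"
  shows "0 < transfer s (\<lambda>_. 1) x" "transfer s (\<lambda>_. 1) x \<le> transfer s (\<lambda>_. 1) 0"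
proof -
  have h: "((\<lambda>a::nat. (1 / (real a + x)) powr (2 * s) * 1) has_sum transfer s (\<lambda>_. 1) x) {1..}"
    if "x \<in> {0..1}" for x
    using transfer_has_sum[OF admissible_const[OF assms(1)] that] by simp
  have "sum (\<lambda>a::nat. (1 / (real a + x)) powr (2 * s) * 1) {1} \<le> transfer s (\<lambda>_. 1) x"
    by (rule finite_sum_le_has_sum[OF h[OF assms(2)]]) auto
  then have "(1 / (1 + x)) powr (2 * s) \<le> transfer s (\<lambda>_. 1) x" by simp
  moreover have "0 < (1 / (1 + x)) powr (2 * s)" using assms by auto
  ultimately show "0 < transfer s (\<lambda>_. 1) x" by (rule less_le_trans[rotated])
  show "transfer s (\<lambda>_. 1) x \<le> transfer s (\<lambda>_. 1) 0"
    by (rule has_sum_mono[OF h[OF assms(2)] h])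
      (use assms in \<open>auto intro!: powr_mono2 simp: field_simps\<close>)
qed

lemma transfer_bounded:
  assumes "s > 1/2" "\<And>y. y \<in> {0..1} \<Longrightarrow> \<bar>f y\<bar> \<le> C" "x \<in> {0..1}"
  shows "\<bar>transfer s f x\<bar> \<le> C * transfer s (\<lambda>_. 1) 0"
proof -
  have C: "0 \<le> C" using assms(2)[of 0] by simp
  have f: "admissible s f" using admissible_bounded assms by blast
  have g: "admissible s (\<lambda>_. c)" for c :: real
    using admissible_cmult[OF admissible_const[OF assms(1)], of c] by simp
  have b: "- C \<le> f y" "f y \<le> C" if "y \<in> {0<..1}" for y using assms(2)[of y] that by auto
  have "transfer s f x \<le> C * transfer s (\<lambda>_. 1) x"
    using transfer_mono[OF f g[of C] assms(3) b(2)] transfer_cmult[of s C "\<lambda>_. 1" x] by simp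
  moreover have "(-C) * transfer s (\<lambda>_. 1) x \<le> transfer s f x"
    using transfer_mono[OF g[of "-C"] f assms(3) b(1)] transfer_cmult[of s "-C" "\<lambda>_. 1" x] by simp
  moreover have "C * transfer s (\<lambda>_. 1) x \<le> C * transfer s (\<lambda>_. 1) 0"
    using transfer_one_bounds(2)[OF assms(1,3)] C by (rule mult_left_mono)
  ultimately show ?thesis by linarith
qed

section \<open>Iterates of the operator as sums over words\<close>

abbreviation iterate :: "real \<Rightarrow> nat \<Rightarrow> (real \<Rightarrow> real) \<Rightarrow> real \<Rightarrow> real" where
  "iterate s n \<equiv> transfer s ^^ n"

lemma words_0: "words 0 = {[]}"
  by (auto simp: words_def)

lemma words_Suc_bij: "bij_betw (\<lambda>(\<omega>, a). a # \<omega>) (words n \<times> {1..}) (words (Suc n))"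
  unfolding bij_betw_def
proof
  show "inj_on (\<lambda>(\<omega>, a). a # \<omega>) (words n \<times> {1..})" by (auto simp: inj_on_def)
  show "(\<lambda>(\<omega>, a). a # \<omega>) ` (words n \<times> {1..}) = words (Suc n)"
  proof (intro equalityI subsetI)
    fix v assume "v \<in> words (Suc n)"
    then obtain a \<omega> where "v = a # \<omega>" "a \<ge> 1" "\<omega> \<in> words n"
      by (cases v) (auto simp: words_def)
    then show "v \<in> (\<lambda>(\<omega>, a). a # \<omega>) ` (words n \<times> {1..})" by force
  qed (auto simp: words_def)
qed

text \<open>The induction applies the hypothesis to \<open>transfer s f\<close>, which is again
  nonnegative and bounded. The letter summed over in the inner operator is prepended to the word,
  because \<open>cf (a # \<omega>) x = 1 / (a + cf \<omega> x)\<close>; nonnegativity allows the two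
  sums to be merged.\<close>

lemma iterate_has_sum:
  assumes "s > 1/2" "\<And>y. y \<in> {0..1} \<Longrightarrow> 0 \<le> f y" "\<And>y. y \<in> {0..1} \<Longrightarrow> f y \<le> C" "x \<in> {0..1}"
  shows "((\<lambda>\<omega>. weight \<omega> x powr (2 * s) * f (cf \<omega> x)) has_sum iterate s n f x) (words n)"
  using assms(2,3)
proof (induction n arbitrary: f C)
  case 0
  then show ?case using has_sum_finite[of "{[]}" "\<lambda>\<omega>. weight \<omega> x powr (2 * s) * f (cf \<omega> x)"] by (simp add: words_0)
next
  case (Suc n)
  let ?g = "\<lambda>\<omega>. weight \<omega> x powr (2 * s) * transfer s f (cf \<omega> x)"
  let ?f = "\<lambda>\<omega>. weight \<omega> x powr (2 * s) * f (cf \<omega> x)"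
  have bd: "\<And>y. y \<in> {0..1} \<Longrightarrow> \<bar>f y\<bar> \<le> C" using Suc.prems by auto
  have IH: "(?g has_sum iterate s n (transfer s f) x) (words n)"
  proof (rule Suc.IH)
    fix y :: real assume y: "y \<in> {0..1}"
    show "0 \<le> transfer s f y" using Suc.prems y by (intro transfer_nonneg) auto
    show "transfer s f y \<le> C * transfer s (\<lambda>_. 1) 0"
      using transfer_bounded[of s f C, OF assms(1) bd y] by simp
  qed
  have inner: "((\<lambda>a. ?f (case (\<omega>, a) of (\<omega>, a) \<Rightarrow> a # \<omega>)) has_sum ?g \<omega>) {1..}" if "\<omega> \<in> words n" for \<omega>
  proof -
    have \<omega>: "set \<omega> \<subseteq> {1..}" using that by (auto simp: words_def)
    have u: "cf \<omega> x \<in> {0..1}" using cf_unit[OF \<omega> assms(4)] .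
    have "((\<lambda>a::nat. weight \<omega> x powr (2 * s) *
        ((1 / (real a + cf \<omega> x)) powr (2 * s) * f (1 / (real a + cf \<omega> x)))) has_sum ?g \<omega>) {1..}"
      by (intro has_sum_cmult_right transfer_has_sum admissible_bounded[OF assms(1) bd] u)
    moreover have "?f (a # \<omega>) = weight \<omega> x powr (2 * s) *
        ((1 / (real a + cf \<omega> x)) powr (2 * s) * f (1 / (real a + cf \<omega> x)))" for a
      using u weight_bounds(1)[OF \<omega> assms(4)] by (simp add: weight_Cons powr_mult powr_divide)
    ultimately show ?thesis by (simp only: prod.case)
  qed
  have "((\<lambda>p. ?f (case p of (\<omega>, a) \<Rightarrow> a # \<omega>)) has_sum iterate s n (transfer s f) x) (words n \<times> {1..})"
  proof (rule has_sum_SigmaI[OF inner IH])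
    show "(\<lambda>p. ?f (case p of (\<omega>, a) \<Rightarrow> a # \<omega>)) summable_on words n \<times> {1..}"
    proof (rule summable_on_SigmaI[OF inner])
      show "?g summable_on words n" using IH by (rule has_sum_imp_summable)
      fix \<omega> and a :: nat assume "\<omega> \<in> words n" "a \<in> {1..}"
      then have "set (a # \<omega>) \<subseteq> {1..}" by (auto simp: words_def)
      then have "cf (a # \<omega>) x \<in> {0..1}" using cf_unit assms(4) by blast
      then have "0 \<le> f (cf (a # \<omega>) x)" using Suc.prems by blast
      then show "0 \<le> ?f (case (\<omega>, a) of (\<omega>, a) \<Rightarrow> a # \<omega>)" by simp
    qed auto
  qed auto
  then have "(?f has_sum iterate s n (transfer s f) x) (words (Suc n))"
    using has_sum_reindex_bij_betw[OF words_Suc_bij, of ?f n] by blast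
  then show ?case by (simp add: funpow_swap1)
qed

section \<open>Log-Lipschitz functions\<close>

text \<open>The condition that \<open>ln f\<close> is \<open>M\<close>-Lipschitz, in a
  multiplicative form that passes to sums with the same \<open>M\<close>.\<close>

definition log_lip :: "real \<Rightarrow> (real \<Rightarrow> real) \<Rightarrow> bool" where
  "log_lip M f \<longleftrightarrow> (\<forall>x\<in>{0..1}. 0 < f x) \<and>
     (\<forall>x\<in>{0..1}. \<forall>y\<in>{0..1}. f x \<le> exp (M * \<bar>x - y\<bar>) * f y)"

lemma log_lip_pos: "log_lip M f \<Longrightarrow> x \<in> {0..1} \<Longrightarrow> 0 < f x"
  by (simp add: log_lip_def)

lemma log_lipD: "log_lip M f \<Longrightarrow> x \<in> {0..1} \<Longrightarrow> y \<in> {0..1} \<Longrightarrow> f x \<le> exp (M * \<bar>x - y\<bar>) * f y"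
  by (simp add: log_lip_def)

lemma log_lip_one: "log_lip 0 (\<lambda>_. 1)"
  by (simp add: log_lip_def)

lemma log_lip_le:
  assumes "log_lip M f" "0 \<le> M" "x \<in> {0..1}" "y \<in> {0..1}"
  shows "f x \<le> exp M * f y"
proof -
  have "M * \<bar>x - y\<bar> \<le> M * 1" using assms by (intro mult_left_mono) auto
  then have "exp (M * \<bar>x - y\<bar>) * f y \<le> exp M * f y"
    using log_lip_pos[OF assms(1,4)] by (intro mult_right_mono) auto
  then show ?thesis using log_lipD[OF assms(1,3,4)] by linarith
qed

lemma log_lip_bounded:
  assumes "log_lip M f" "0 \<le> M"
  obtains m C where "0 < m" "m \<le> C" "\<And>x. x \<in> {0..1} \<Longrightarrow> m \<le> f x" "\<And>x. x \<in> {0..1} \<Longrightarrow> f x \<le> C"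
proof
  show "0 < exp (-M) * f 0" using log_lip_pos[OF assms(1), of 0] by simp
  show 1: "f x \<le> exp M * f 0" if "x \<in> {0..1}" for x using log_lip_le[OF assms that, of 0] by simp
  show 2: "exp (-M) * f 0 \<le> f x" if "x \<in> {0..1}" for x
    using log_lip_le[OF assms _ that, of 0] by (simp add: exp_minus field_simps)
  show "exp (-M) * f 0 \<le> exp M * f 0" using 1[of 0] 2[of 0] by simp
qed

lemma log_lip_diff_le:
  assumes "log_lip M f" "0 \<le> M" "x \<in> {0..1}" "y \<in> {0..1}" "\<And>x. x \<in> {0..1} \<Longrightarrow> f x \<le> B"
  shows "\<bar>f x - f y\<bar> \<le> B * (exp (M * \<bar>x - y\<bar>) - 1)"
proof -
  have "f u - f v \<le> B * (exp (M * \<bar>u - v\<bar>) - 1)" if "u \<in> {0..1}" "v \<in> {0..1}" for u v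
  proof -
    have "f u - f v \<le> f v * (exp (M * \<bar>u - v\<bar>) - 1)"
      using log_lipD[OF assms(1) that] by (simp add: algebra_simps)
    also have "\<dots> \<le> B * (exp (M * \<bar>u - v\<bar>) - 1)"
      using assms(2,5) that by (intro mult_right_mono) auto
    finally show ?thesis .
  qed
  from this[of x y] this[of y x] show ?thesis using assms(3,4) by (auto simp: abs_le_iff abs_minus_commute)
qed

text \<open>\<open>d\<close> is chosen before \<open>f\<close>: one modulus serves all such
  functions below \<open>B\<close>, as Arzela-Ascoli requires.\<close>

lemma log_lip_equicontinuous:
  assumes "0 \<le> M" "0 < e"
  obtains d where "0 < d" "\<And>f x y. log_lip M f \<Longrightarrow> (\<And>x. x \<in> {0..1} \<Longrightarrow> f x \<le> B) \<Longrightarrow>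
    x \<in> {0..1} \<Longrightarrow> y \<in> {0..1} \<Longrightarrow> \<bar>x - y\<bar> < d \<Longrightarrow> \<bar>f x - f y\<bar> < e"
proof -
  have "((\<lambda>u. B * (exp (M * \<bar>u\<bar>) - 1)) \<longlongrightarrow> B * (exp (M * \<bar>0\<bar>) - 1)) (at 0)"
    by (intro tendsto_intros)
  then obtain d where d: "0 < d" "\<And>u. u \<noteq> 0 \<Longrightarrow> \<bar>u\<bar> < d \<Longrightarrow> \<bar>B * (exp (M * \<bar>u\<bar>) - 1)\<bar> < e"
    using assms(2) unfolding LIM_def by (auto simp: dist_real_def)
  show ?thesis
  proof (rule that[OF d(1)])
    fix f x y assume f: "log_lip M f" "\<And>x. x \<in> {0..1} \<Longrightarrow> f x \<le> B"
      and x: "x \<in> {0..1}" and y: "y \<in> {0..1}" and "\<bar>x - y\<bar> < d"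
    then show "\<bar>f x - f y\<bar> < e"
      using log_lip_diff_le[of M f x y B, OF f(1) assms(1) x y f(2)] d(2)[of "x - y"] assms(2)
      by (cases "x = y") auto
  qed
qed

lemma log_lip_continuous:
  assumes "log_lip M f" "0 \<le> M"
  shows "continuous_on {0..1} f"
  unfolding continuous_on_iff
proof (intro ballI allI impI)
  fix x e :: real assume x: "x \<in> {0..1}" and e: "0 < e"
  obtain m C where "0 < m" "m \<le> C" and C: "\<And>x. x \<in> {0..1} \<Longrightarrow> m \<le> f x" "\<And>x. x \<in> {0..1} \<Longrightarrow> f x \<le> C"
    using log_lip_bounded[OF assms] by metis
  obtain d where "0 < d" "\<And>f x y. log_lip M f \<Longrightarrow> (\<And>x. x \<in> {0..1} \<Longrightarrow> f x \<le> C) \<Longrightarrow>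
    x \<in> {0..1} \<Longrightarrow> y \<in> {0..1} \<Longrightarrow> \<bar>x - y\<bar> < d \<Longrightarrow> \<bar>f x - f y\<bar> < e"
    using log_lip_equicontinuous[OF assms(2) e] by metis
  then show "\<exists>d>0. \<forall>x'\<in>{0..1}. dist x' x < d \<longrightarrow> dist (f x') (f x) < e"
    using assms(1) C x unfolding dist_real_def by blast
qed

lemma log_lip_admissible:
  assumes "s > 1/2" "0 \<le> M" "log_lip M f"
  shows "admissible s f"
proof (rule admissible_bounded[OF assms(1)])
  fix y :: real assume "y \<in> {0..1}"
  then show "\<bar>f y\<bar> \<le> exp M * f 0"
    using log_lip_le[OF assms(3,2), of y 0] log_lip_pos[OF assms(3), of y] by simp
qed

lemma log_lip_cmult:
  assumes "log_lip M f" "0 < c"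
  shows "log_lip M (\<lambda>x. c * f x)"
  using assms unfolding log_lip_def by (auto simp: mult.left_commute)

lemma log_lip_sum:
  assumes "finite I" "I \<noteq> {}" "\<And>i. i \<in> I \<Longrightarrow> log_lip M (f i)"
  shows "log_lip M (\<lambda>x. \<Sum>i\<in>I. f i x)"
  using assms unfolding log_lip_def by (auto simp: sum_distrib_left intro!: sum_pos sum_mono)

lemma has_sum_log_lip:
  assumes "\<And>x. x \<in> {0..1} \<Longrightarrow> ((\<lambda>i. f i x) has_sum S x) I" "I \<noteq> {}" "\<And>i. i \<in> I \<Longrightarrow> log_lip M (f i)"
  shows "log_lip M S"
  unfolding log_lip_def
proof (intro conjI ballI)
  fix x y :: real assume x: "x \<in> {0..1}" and y: "y \<in> {0..1}"
  show "S x \<le> exp (M * \<bar>x - y\<bar>) * S y"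
    by (rule has_sum_mono[OF assms(1)[OF x] has_sum_cmult_right[OF assms(1)[OF y]]])
      (use assms(3) x y in \<open>auto simp: log_lip_def\<close>)
next
  fix x :: real assume x: "x \<in> {0..1}"
  obtain i where i: "i \<in> I" using assms(2) by auto
  have "sum (\<lambda>i. f i x) {i} \<le> S x"
    by (rule finite_sum_le_has_sum[OF assms(1)[OF x]])
      (use i log_lip_pos[OF assms(3) x] in \<open>auto intro: less_imp_le\<close>)
  then show "0 < S x" using log_lip_pos[OF assms(3)[OF i] x] by simp
qed

text \<open>Distortion of the weight contributes \<open>2 * s\<close>; the branch does not expand
  distances, so \<open>f\<close> contributes only its own \<open>M\<close>.\<close>

lemma weighted_branch_log_lip:
  assumes "s > 1/2" "0 \<le> M" "log_lip M f" and \<omega>: "set \<omega> \<subseteq> {1..}"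
  shows "log_lip (2 * s + M) (\<lambda>x. weight \<omega> x powr (2 * s) * f (cf \<omega> x))"
  unfolding log_lip_def
proof (intro conjI ballI)
  fix x :: real assume x: "x \<in> {0..1}"
  show "0 < weight \<omega> x powr (2 * s) * f (cf \<omega> x)"
    using weight_bounds(1)[OF \<omega> x] log_lip_pos[OF assms(3) cf_unit[OF \<omega> x]] by simp
  fix y :: real assume y: "y \<in> {0..1}"
  have "weight \<omega> x powr (2 * s) \<le> (exp \<bar>x - y\<bar> * weight \<omega> y) powr (2 * s)"
    using assms(1) weight_bounds(1)[OF \<omega> x] weight_log_lipschitz[OF \<omega> x y]
    by (intro powr_mono2) auto
  also have "\<dots> = exp (2 * s * \<bar>x - y\<bar>) * weight \<omega> y powr (2 * s)"
    using weight_bounds(1)[OF \<omega> y] by (simp add: powr_mult exp_powr_real mult.commute)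
  finally have 1: "weight \<omega> x powr (2 * s) \<le> exp (2 * s * \<bar>x - y\<bar>) * weight \<omega> y powr (2 * s)" .
  have "M * \<bar>cf \<omega> x - cf \<omega> y\<bar> \<le> M * \<bar>x - y\<bar>"
    using cf_lipschitz[OF \<omega> x y] assms(2) by (rule mult_left_mono)
  then have "exp (M * \<bar>cf \<omega> x - cf \<omega> y\<bar>) * f (cf \<omega> y) \<le> exp (M * \<bar>x - y\<bar>) * f (cf \<omega> y)"
    using log_lip_pos[OF assms(3) cf_unit[OF \<omega> y]] by (intro mult_right_mono) auto
  then have 2: "f (cf \<omega> x) \<le> exp (M * \<bar>x - y\<bar>) * f (cf \<omega> y)"
    using log_lipD[OF assms(3) cf_unit[OF \<omega> x] cf_unit[OF \<omega> y]] by linarith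
  have "weight \<omega> x powr (2 * s) * f (cf \<omega> x)
      \<le> (exp (2 * s * \<bar>x - y\<bar>) * weight \<omega> y powr (2 * s)) * (exp (M * \<bar>x - y\<bar>) * f (cf \<omega> y))"
    by (rule mult_mono[OF 1 2]) (use log_lip_pos[OF assms(3) cf_unit[OF \<omega> x]] in auto)
  then show "weight \<omega> x powr (2 * s) * f (cf \<omega> x)
      \<le> exp ((2 * s + M) * \<bar>x - y\<bar>) * (weight \<omega> y powr (2 * s) * f (cf \<omega> y))"
    unfolding distrib_right exp_add by (simp only: mult_ac)
qed

text \<open>The constant is the same for all \<open>n\<close> because it is read off the single sum
  over words; going one application at a time would add \<open>2 * s\<close> at each step.\<close>

lemma iterate_log_lip:
  assumes "s > 1/2" "0 \<le> M" "log_lip M f"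
  shows "log_lip (2 * s + M) (iterate s n f)"
proof (rule has_sum_log_lip)
  obtain m C where "0 < m" "m \<le> C" and C: "\<And>x. x \<in> {0..1} \<Longrightarrow> m \<le> f x" "\<And>x. x \<in> {0..1} \<Longrightarrow> f x \<le> C"
    using log_lip_bounded[OF assms(3,2)] by metis
  show "((\<lambda>\<omega>. weight \<omega> x powr (2 * s) * f (cf \<omega> x)) has_sum iterate s n f x) (words n)"
    if "x \<in> {0..1}" for x
    by (rule iterate_has_sum[OF assms(1) _ C(2) that]) (use log_lip_pos[OF assms(3)] in force)+
  have "replicate n 1 \<in> words n" by (auto simp: words_def)
  then show "words n \<noteq> {}" by auto
next
  fix \<omega> assume "\<omega> \<in> words n"
  then have \<omega>: "set \<omega> \<subseteq> {1..}" by (simp add: words_def)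
  show "log_lip (2 * s + M) (\<lambda>x. weight \<omega> x powr (2 * s) * f (cf \<omega> x))"
    by (rule weighted_branch_log_lip[OF assms \<omega>])
qed

lemma transfer_log_lip:
  assumes "s > 1/2" "0 \<le> M" "log_lip M f"
  shows "log_lip (2 * s + M) (transfer s f)"
  using iterate_log_lip[OF assms, of 1] by simp

lemma iterate_cmult: "iterate s n (\<lambda>y. c * f y) = (\<lambda>x. c * iterate s n f x)"
  by (induction n) (auto simp: transfer_cmult)

lemma iterate_mono:
  assumes "s > 1/2" "\<And>y. y \<in> {0..1} \<Longrightarrow> 0 \<le> f y" "\<And>y. y \<in> {0..1} \<Longrightarrow> f y \<le> g y"
    "\<And>y. y \<in> {0..1} \<Longrightarrow> g y \<le> C" "x \<in> {0..1}"
  shows "iterate s n f x \<le> iterate s n g x"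
proof (rule has_sum_mono)
  have b: "0 \<le> g y" "f y \<le> C" if "y \<in> {0..1}" for y
    using assms(2-4)[OF that] by linarith+
  show "((\<lambda>\<omega>. weight \<omega> x powr (2 * s) * f (cf \<omega> x)) has_sum iterate s n f x) (words n)"
    using iterate_has_sum[of s f C x n] assms b by blast
  show "((\<lambda>\<omega>. weight \<omega> x powr (2 * s) * g (cf \<omega> x)) has_sum iterate s n g x) (words n)"
    using iterate_has_sum[of s g C x n] assms b by blast
  fix \<omega> assume "\<omega> \<in> words n"
  then have "cf \<omega> x \<in> {0..1}" using cf_unit assms(5) by (auto simp: words_def)
  then show "weight \<omega> x powr (2 * s) * f (cf \<omega> x) \<le> weight \<omega> x powr (2 * s) * g (cf \<omega> x)"
    using assms(3) by (intro mult_left_mono) auto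
qed

section \<open>The pressure as a growth rate\<close>

text \<open>Cutting \<open>m * n\<close> into \<open>m\<close> blocks of length \<open>n\<close> or
  into \<open>n\<close> blocks of length \<open>m\<close> puts every \<open>(a n - c) / n\<close>
  below every \<open>(a m + c) / m\<close>; the supremum of the former is the slope.\<close>

lemma almost_additive_slope:
  fixes a :: "nat \<Rightarrow> real"
  assumes "\<And>m n. \<bar>a (m + n) - a m - a n\<bar> \<le> c"
  obtains p where "\<And>n. \<bar>a n - real n * p\<bar> \<le> c"
proof -
  \<comment> \<open>At least one block is taken: for zero blocks the bound would force
    \<open>a 0 = 0\<close>.\<close>
  have mult: "\<bar>a (Suc k * n) - real (Suc k) * a n\<bar> \<le> real (Suc k) * c" for k n
  proof (induction k)
    case 0
    show ?case using assms[of 0 0] by simp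
  next
    case (Suc k)
    have "\<bar>a (Suc (Suc k) * n) - real (Suc (Suc k)) * a n\<bar>
        \<le> \<bar>a (n + Suc k * n) - a n - a (Suc k * n)\<bar> + \<bar>a (Suc k * n) - real (Suc k) * a n\<bar>"
      by (simp add: algebra_simps)
    then show ?case using assms[of n "Suc k * n"] Suc by (simp add: algebra_simps)
  qed
  have cross: "(a n - c) / real n \<le> (a m + c) / real m" if "1 \<le> n" "1 \<le> m" for m n
  proof -
    have "\<bar>a (m * n) - real m * a n\<bar> \<le> real m * c" "\<bar>a (n * m) - real n * a m\<bar> \<le> real n * c"
      using mult[of "m - 1" n] mult[of "n - 1" m] that by simp_all
    then have "real m * (a n - c) \<le> real n * (a m + c)"
      by (simp add: mult.commute[of n m] abs_le_iff algebra_simps)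
    then show ?thesis using that by (simp add: field_simps)
  qed
  define p where "p = (SUP n\<in>{1..}. (a n - c) / real n)"
  have bdd: "bdd_above ((\<lambda>n. (a n - c) / real n) ` {1..})"
    by (rule bdd_aboveI2[where M = "(a 1 + c) / real 1"]) (use cross[of _ 1] in auto)
  have "\<bar>a n - real n * p\<bar> \<le> c" for n
  proof (cases "n = 0")
    case True
    then show ?thesis using assms[of 0 0] by simp
  next
    case False
    have "(a n - c) / real n \<le> p" unfolding p_def by (rule cSUP_upper[OF _ bdd]) (use False in auto)
    moreover have "p \<le> (a n + c) / real n"
      unfolding p_def by (rule cSUP_least) (use False cross in auto)
    ultimately show ?thesis using False by (simp add: field_simps abs_le_iff)
  qed
  then show ?thesis by (rule that)
qed

lemma nonpos_if_multiples_bounded: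
  fixes d :: real
  assumes "\<And>n. real n * d \<le> K"
  shows "d \<le> 0"
proof (rule ccontr)
  assume "\<not> d \<le> 0"
  then obtain n where "K < real n * d" using reals_Archimedean3[of d] by auto
  then show False using assms[of n] by simp
qed

text \<open>Evaluated at \<open>0\<close> because each summand in \<open>pressure\<close> attains
  its supremum there, by \<open>pressure_summand\<close>.\<close>

definition partition_function :: "real \<Rightarrow> nat \<Rightarrow> real" where
  "partition_function s n = iterate s n (\<lambda>_. 1) 0"

lemma partition_function_pos:
  assumes "s > 1/2"
  shows "0 < partition_function s n"
  unfolding partition_function_def
  using log_lip_pos[OF iterate_log_lip[OF assms _ log_lip_one, of n], of 0] by simp

lemma iterate_one_bounds:
  assumes "s > 1/2" "x \<in> {0..1}"
  shows "iterate s n (\<lambda>_. 1) x \<le> exp (2 * s) * partition_function s n"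
    "exp (- (2 * s)) * partition_function s n \<le> iterate s n (\<lambda>_. 1) x"
proof -
  have l: "log_lip (2 * s) (iterate s n (\<lambda>_. 1))" using iterate_log_lip[OF assms(1) _ log_lip_one] by simp
  show "iterate s n (\<lambda>_. 1) x \<le> exp (2 * s) * partition_function s n"
    unfolding partition_function_def using log_lip_le[OF l _ assms(2), of 0] assms by simp
  show "exp (- (2 * s)) * partition_function s n \<le> iterate s n (\<lambda>_. 1) x"
    unfolding partition_function_def using log_lip_le[OF l _ _ assms(2), of 0] assms
    by (simp add: exp_minus field_simps)
qed

text \<open>By distortion the inner iterate of \<open>1\<close> agrees with its value at
  \<open>0\<close> up to a factor \<open>exp (2 * s)\<close>, and the outer iterate is monotone and
  homogeneous.\<close>

lemma partition_function_add:
  assumes "s > 1/2"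
  shows "\<bar>ln (partition_function s (m + n)) - ln (partition_function s m) - ln (partition_function s n)\<bar> \<le> 2 * s"
proof -
  let ?Z = "partition_function s"
  let ?g = "iterate s n (\<lambda>_. 1)"
  have Z: "?Z (m + n) = iterate s m ?g 0" unfolding partition_function_def by (simp add: funpow_add)
  have nn: "0 \<le> exp (- (2 * s)) * ?Z n" using partition_function_pos[OF assms, of n] by simp
  have c: "iterate s m (\<lambda>_. c) 0 = c * ?Z m" for c
    using iterate_cmult[of m s c "\<lambda>_. 1"] unfolding partition_function_def by simp
  have "iterate s m ?g 0 \<le> iterate s m (\<lambda>_. exp (2 * s) * ?Z n) 0"
  proof (rule iterate_mono[OF assms])
    fix y :: real assume "y \<in> {0..1}"
    then show "0 \<le> ?g y" "?g y \<le> exp (2 * s) * ?Z n"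
      using iterate_one_bounds[OF assms, of y n] nn by linarith+
  qed auto
  then have u: "?Z (m + n) \<le> exp (2 * s) * (?Z m * ?Z n)" unfolding Z c by (simp add: mult_ac)
  have "iterate s m (\<lambda>_. exp (- (2 * s)) * ?Z n) 0 \<le> iterate s m ?g 0"
    by (rule iterate_mono[OF assms]) (use nn iterate_one_bounds[OF assms] in auto)
  then have l: "exp (- (2 * s)) * (?Z m * ?Z n) \<le> ?Z (m + n)" unfolding Z c by (simp add: mult_ac)
  have "ln (?Z (m + n)) \<le> ln (exp (2 * s) * (?Z m * ?Z n))"
    "ln (exp (- (2 * s)) * (?Z m * ?Z n)) \<le> ln (?Z (m + n))"
    using u l partition_function_pos[OF assms] by (simp_all del: ln_exp)
  then show ?thesis using partition_function_pos[OF assms]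
    by (simp add: ln_mult_pos abs_le_iff)
qed

text \<open>Almost additivity gives convergence together with an error independent of
  \<open>n\<close>, so exponential bounds on all partition functions carry over to the pressure
  without loss.\<close>

theorem pressure_bounds:
  assumes "s > 1/2"
  shows "\<bar>ln (partition_function s n) - real n * pressure s\<bar> \<le> 2 * s"
proof -
  obtain p where p: "\<And>n. \<bar>ln (partition_function s n) - real n * p\<bar> \<le> 2 * s"
    using almost_additive_slope[of "\<lambda>n. ln (partition_function s n)", OF partition_function_add[OF assms]]
    by metis
  have Z: "(\<Sum>\<^sub>\<infinity>\<omega>\<in>words n. exp (SUP x\<in>{0..1}. ln (\<Prod>j<n. cf (drop j \<omega>) x powr (2 * s))))
      = partition_function s n" for n
  proof -
    have "((\<lambda>\<omega>. weight \<omega> 0 powr (2 * s) * 1) has_sum iterate s n (\<lambda>_. 1) 0) (words n)"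
      using iterate_has_sum[of s "\<lambda>_. 1" 1 0 n] assms by simp
    then have "(\<Sum>\<^sub>\<infinity>\<omega>\<in>words n. weight \<omega> 0 powr (2 * s)) = partition_function s n"
      unfolding partition_function_def by (simp add: infsumI)
    moreover have "(\<Sum>\<^sub>\<infinity>\<omega>\<in>words n. exp (SUP x\<in>{0..1}. ln (\<Prod>j<n. cf (drop j \<omega>) x powr (2 * s))))
      = (\<Sum>\<^sub>\<infinity>\<omega>\<in>words n. weight \<omega> 0 powr (2 * s))"
      by (rule infsum_cong) (use pressure_summand assms in auto)
    ultimately show ?thesis by simp
  qed
  have "(\<lambda>n. 1 / real n * ln (partition_function s n)) \<longlonglongrightarrow> p"
  proof (rule LIM_zero_cancel, rule Lim_null_comparison)
    show "\<forall>\<^sub>F n in sequentially. norm (1 / real n * ln (partition_function s n) - p) \<le> 2 * s / real n"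
      using eventually_gt_at_top[of 0]
    proof eventually_elim
      case (elim n)
      have "1 / real n * ln (partition_function s n) - p = (ln (partition_function s n) - real n * p) / real n"
        using elim by (simp add: field_simps)
      then show ?case using p[of n] elim by (simp add: abs_divide divide_right_mono)
    qed
    show "(\<lambda>n. 2 * s / real n) \<longlonglongrightarrow> 0" by (rule lim_const_over_n)
  qed
  then have "pressure s = p" unfolding pressure_def Z by (rule limI)
  then show ?thesis using p by simp
qed

text \<open>Iterating the inequality gives \<open>iterate s n f x \<le> \<mu> ^ n * f x\<close>; as
  \<open>f\<close> lies between positive constants, the same holds for \<open>1\<close> up to a
  factor that the growth rate does not see.\<close>

lemma pressure_le_if_supersolution:
  assumes "s > 1/2" "0 < m" "0 < \<mu>"
    and f: "\<And>x. x \<in> {0..1} \<Longrightarrow> m \<le> f x" "\<And>x. x \<in> {0..1} \<Longrightarrow> f x \<le> C"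
    and le: "\<And>x. x \<in> {0..1} \<Longrightarrow> transfer s f x \<le> \<mu> * f x"
  shows "pressure s \<le> ln \<mu>"
proof -
  have f0: "0 \<le> f x" if "x \<in> {0..1}" for x using f(1)[OF that] assms(2) by simp
  have it: "iterate s n f x \<le> \<mu> ^ n * f x" if x: "x \<in> {0..1}" for n x
  proof (induction n)
    case (Suc n)
    have "iterate s (Suc n) f x = iterate s n (transfer s f) x" by (simp add: funpow_swap1)
    also have "\<dots> \<le> iterate s n (\<lambda>y. \<mu> * f y) x"
    proof (rule iterate_mono[OF assms(1) _ le _ x])
      fix y :: real assume y: "y \<in> {0..1}"
      show "0 \<le> transfer s f y" by (rule transfer_nonneg[OF _ y]) (use f0 in auto)
      show "\<mu> * f y \<le> \<mu> * C" using f(2)[OF y] assms(3) by simp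
    qed
    also have "\<dots> \<le> \<mu> * (\<mu> ^ n * f x)" unfolding iterate_cmult using Suc assms(3) by simp
    finally show ?case by (simp add: mult_ac)
  qed simp
  have C: "0 < C" using f[of 0] assms(2) by auto
  have "real n * (pressure s - ln \<mu>) \<le> 2 * s + ln (C / m)" for n
  proof -
    have "m * partition_function s n = iterate s n (\<lambda>_. m) 0"
      unfolding partition_function_def using iterate_cmult[of n s m "\<lambda>_. 1"] by simp
    also have "\<dots> \<le> iterate s n f 0"
      by (rule iterate_mono[OF assms(1) _ f]) (use assms(2) in auto)
    also have "\<dots> \<le> \<mu> ^ n * C"
      by (rule order_trans[OF it mult_left_mono[OF f(2)]]) (use assms(3) in auto)
    finally have "partition_function s n \<le> \<mu> ^ n * (C / m)" using assms(2) by (simp add: field_simps)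
    then have "ln (partition_function s n) \<le> ln (\<mu> ^ n * (C / m))"
      using partition_function_pos[OF assms(1), of n] assms(2,3) C by simp
    also have "\<dots> = real n * ln \<mu> + ln (C / m)"
      using assms(2,3) C ln_mult_pos[of "\<mu> ^ n" "C / m"] by (simp add: ln_realpow)
    finally show ?thesis using pressure_bounds[OF assms(1), of n] by (simp add: abs_le_iff algebra_simps)
  qed
  then show ?thesis using nonpos_if_multiples_bounded by force
qed

section \<open>Lower bounds for the pressure\<close>

lemma pressure_ge_if_partition_function_ge:
  assumes "s > 1/2" "\<And>n. real n * u \<le> ln (partition_function s n)"
  shows "u \<le> pressure s"
proof -
  have "real n * (u - pressure s) \<le> 2 * s" for n
    using pressure_bounds[OF assms(1), of n] assms(2)[of n] by (simp add: abs_le_iff algebra_simps)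
  then show ?thesis using nonpos_if_multiples_bounded by force
qed

text \<open>Dropping the letters beyond \<open>N\<close> and putting \<open>x = 1\<close>, where
  each term is smallest, bounds the operator on \<open>1\<close> below by a constant, whose powers
  bound the partition functions. The finite sum stays meaningful at \<open>s = 1/2\<close>, which
  serves the blow-up there.\<close>

lemma pressure_ge_partial_sum:
  assumes "s > 1/2" "N \<ge> 1"
  shows "ln (\<Sum>a=1..N. (1 / (real a + 1)) powr (2 * s)) \<le> pressure s"
proof (rule pressure_ge_if_partition_function_ge[OF assms(1)])
  let ?v = "\<Sum>a=1..N. (1 / (real a + 1)) powr (2 * s)"
  have v: "0 < ?v" by (rule sum_pos) (use assms(2) in auto)
  have ge: "?v \<le> transfer s (\<lambda>_. 1) x" if x: "x \<in> {0..1}" for x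
  proof -
    have "?v \<le> (\<Sum>a=1..N. (1 / (real a + x)) powr (2 * s) * 1)"
      using x assms(1) by (intro sum_mono) (auto intro!: powr_mono2 simp: field_simps)
    also have "\<dots> \<le> transfer s (\<lambda>_. 1) x"
      by (rule finite_sum_le_has_sum[OF transfer_has_sum[OF admissible_const[OF assms(1)] x]]) auto
    finally show ?thesis .
  qed
  have "?v ^ n \<le> partition_function s n" for n
  proof (induction n)
    case (Suc n)
    have "?v ^ Suc n \<le> ?v * partition_function s n" using Suc v by simp
    also have "\<dots> = iterate s n (\<lambda>_. ?v) 0"
      unfolding partition_function_def using iterate_cmult[of n s ?v "\<lambda>_. 1"] by simp
    also have "\<dots> \<le> iterate s n (transfer s (\<lambda>_. 1)) 0"
      by (rule iterate_mono[OF assms(1) _ ge transfer_one_bounds(2)[OF assms(1)]]) (use v in auto)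
    also have "\<dots> = partition_function s (Suc n)"
      unfolding partition_function_def by (simp add: funpow_swap1)
    finally show ?case .
  qed (simp add: partition_function_def)
  then have "ln (?v ^ n) \<le> ln (partition_function s n)" for n
    using v partition_function_pos[OF assms(1), of n] by (metis ln_le_cancel_iff zero_less_power)
  then show "real n * ln ?v \<le> ln (partition_function s n)" for n using v by (simp add: ln_realpow)
qed

text \<open>The fixed point \<open>[1, 1, 1, \<dots>]\<close> of the branch \<open>a = 1\<close> has derivative \<open>exp (- \<gamma>\<^sub>0)\<close>.\<close>

lemma pressure_ge_golden:
  assumes "s > 1/2"
  shows "- (s * \<gamma>\<^sub>0) \<le> pressure s"
proof (rule pressure_ge_if_partition_function_ge[OF assms])
  fix n
  define r :: real where "r = 1 + sqrt 5"
  \<comment> \<open>The reciprocal of the golden ratio, the positive root of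
    \<open>g * (1 + g) = 1\<close>.\<close>
  define g where "g = 2 / r"
  have r: "2 < r" "r * r = 2 * r + 4" unfolding r_def by (auto simp: algebra_simps real_less_rsqrt)
  have g: "0 < g" "g \<in> {0..1}" unfolding g_def using r by auto
  have "0 < 1 + g" using g by simp
  moreover have "g * (1 + g) = 1"
    unfolding g_def using r by (simp add: field_simps)
  ultimately have fp: "1 / (1 + g) = g" by (simp add: field_simps)
  have cf1: "cf (replicate k 1) g = g" for k by (induction k) (use fp in auto)
  have w1: "weight (replicate k 1) g = g ^ k" for k
  proof (induction k)
    case (Suc k)
    then show ?case using cf1[of "Suc k"] by (simp add: weight_Cons)
  qed simp
  have word: "replicate n 1 \<in> words n" by (auto simp: words_def)
  then have "set (replicate n 1) \<subseteq> {1::nat..}" by (simp add: words_def)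
  from weight_bounds(2)[OF this g(2)] have w0: "g ^ n \<le> weight (replicate n 1) 0" unfolding w1 .
  have hs: "((\<lambda>\<omega>. weight \<omega> 0 powr (2 * s) * 1) has_sum partition_function s n) (words n)"
    unfolding partition_function_def using iterate_has_sum[of s "\<lambda>_. 1" 1 0 n] assms by simp
  \<comment> \<open>Only the word \<open>1, ..., 1\<close> is kept; its weight at \<open>0\<close>
    is at least its weight \<open>g ^ n\<close> at the fixed point.\<close>
  have "(g ^ n) powr (2 * s) \<le> weight (replicate n 1) 0 powr (2 * s)"
    using w0 g assms by (intro powr_mono2) auto
  also have "\<dots> = sum (\<lambda>\<omega>. weight \<omega> 0 powr (2 * s) * 1) {replicate n 1}" by simp
  also have "\<dots> \<le> partition_function s n"
    by (rule finite_sum_le_has_sum[OF hs]) (use word in auto)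
  finally have "ln ((g ^ n) powr (2 * s)) \<le> ln (partition_function s n)"
    using g partition_function_pos[OF assms, of n] by (subst ln_le_cancel_iff) auto
  moreover have "ln g = - ln ((1 + sqrt 5) / 2)" unfolding g_def r_def[symmetric] using r by (simp add: ln_div)
  ultimately show "real n * - (s * \<gamma>\<^sub>0) \<le> ln (partition_function s n)"
    unfolding \<gamma>\<^sub>0_def using g by (simp add: ln_powr ln_realpow algebra_simps)
qed

section \<open>Eigenfunctions\<close>

text \<open>\<open>b\<close> lies between positive constants, the iterates of \<open>1\<close> are
  within distortion of the partition function, and that is within \<open>exp (2 * s)\<close> of the
  pure exponential.\<close>

lemma iterate_scaled_bounds:
  assumes "s > 1/2" "0 \<le> M" "log_lip M b"
  obtains m C where "0 < m"
    "\<And>j x. x \<in> {0..1} \<Longrightarrow> m \<le> iterate s j b x / exp (pressure s) ^ j"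
    "\<And>j x. x \<in> {0..1} \<Longrightarrow> iterate s j b x / exp (pressure s) ^ j \<le> C"
proof -
  obtain m C where m: "0 < m" "m \<le> C" and b: "\<And>x. x \<in> {0..1} \<Longrightarrow> m \<le> b x" "\<And>x. x \<in> {0..1} \<Longrightarrow> b x \<le> C"
    using log_lip_bounded[OF assms(3,2)] by metis
  have Z: "exp (- (2 * s)) * exp (pressure s) ^ j \<le> partition_function s j"
    "partition_function s j \<le> exp (2 * s) * exp (pressure s) ^ j" for j
  proof -
    have "- (2 * s) + real j * pressure s \<le> ln (partition_function s j)"
      "ln (partition_function s j) \<le> 2 * s + real j * pressure s"
      using pressure_bounds[OF assms(1), of j] by (auto simp: abs_le_iff)
    then have "exp (- (2 * s) + real j * pressure s) \<le> exp (ln (partition_function s j))"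
      "exp (ln (partition_function s j)) \<le> exp (2 * s + real j * pressure s)"
      by (simp_all only: exp_le_cancel_iff)
    then show "exp (- (2 * s)) * exp (pressure s) ^ j \<le> partition_function s j"
      "partition_function s j \<le> exp (2 * s) * exp (pressure s) ^ j"
      using partition_function_pos[OF assms(1), of j] unfolding exp_add exp_of_nat_mult by simp_all
  qed
  have c: "iterate s j (\<lambda>_. c) x = c * iterate s j (\<lambda>_. 1) x" for c j x
    using iterate_cmult[of j s c "\<lambda>_. 1"] by (metis mult.right_neutral)
  show ?thesis
  proof (rule that)
    \<comment> \<open>One factor \<open>exp (- (2 * s))\<close> comes from distortion, the other
      from \<open>pressure_bounds\<close>.\<close>
    show "0 < m * (exp (- (2 * s)) * exp (- (2 * s)))" using m by simp
    fix j and x :: real assume x: "x \<in> {0..1}"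
    let ?l = "exp (pressure s) ^ j"
    have "m * (exp (- (2 * s)) * (exp (- (2 * s)) * ?l)) \<le> m * (exp (- (2 * s)) * partition_function s j)"
      using Z(1)[of j] m by (intro mult_left_mono) auto
    also have "\<dots> \<le> m * iterate s j (\<lambda>_. 1) x"
      using iterate_one_bounds(2)[OF assms(1) x, of j] m by (intro mult_left_mono) auto
    also have "\<dots> = iterate s j (\<lambda>_. m) x" by (rule c[symmetric])
    also have "\<dots> \<le> iterate s j b x"
      by (rule iterate_mono[OF assms(1) _ b x]) (use m in auto)
    finally show "m * (exp (- (2 * s)) * exp (- (2 * s))) \<le> iterate s j b x / ?l"
      by (simp add: pos_le_divide_eq mult.assoc)
    have "iterate s j b x \<le> iterate s j (\<lambda>_. C) x"
      by (rule iterate_mono[where f = b and C = C, OF assms(1) _ b(2) _ x]) (use b(1) m in force)+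
    also have "\<dots> = C * iterate s j (\<lambda>_. 1) x" by (rule c)
    also have "\<dots> \<le> C * (exp (2 * s) * partition_function s j)"
      using iterate_one_bounds(1)[OF assms(1) x, of j] m by (intro mult_left_mono) auto
    also have "\<dots> \<le> C * (exp (2 * s) * (exp (2 * s) * ?l))"
      using Z(2)[of j] m by (intro mult_left_mono) auto
    finally show "iterate s j b x / ?l \<le> C * (exp (2 * s) * exp (2 * s))"
      by (simp add: pos_divide_le_eq mult.assoc)
  qed
qed

text \<open>Cesaro mean of the normalised iterates. The factor stands inside the sum so that each
  summand is a constant multiple of an iterate, to which linearity and \<open>log_lip_sum\<close>
  apply.\<close>

definition average :: "real \<Rightarrow> (real \<Rightarrow> real) \<Rightarrow> nat \<Rightarrow> real \<Rightarrow> real" where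
  "average s b N x = (\<Sum>j\<le>N. 1 / (real (Suc N) * exp (pressure s) ^ j) * iterate s j b x)"

lemma average_alt: "average s b N x = (\<Sum>j\<le>N. iterate s j b x / exp (pressure s) ^ j) / real (Suc N)"
  unfolding average_def sum_divide_distrib by (intro sum.cong) auto

lemma admissible_sum:
  assumes "finite I" "\<And>i. i \<in> I \<Longrightarrow> admissible s (f i)"
  shows "admissible s (\<lambda>x. \<Sum>i\<in>I. f i x)"
  using assms
proof (induction I)
  case empty
  then show ?case by (simp add: admissible_def)
qed (auto intro: admissible_add)

lemma transfer_sum:
  assumes "finite I" "\<And>i. i \<in> I \<Longrightarrow> admissible s (f i)" "x \<in> {0..1}"
  shows "transfer s (\<lambda>x. \<Sum>i\<in>I. f i x) x = (\<Sum>i\<in>I. transfer s (f i) x)"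
  using assms(1,2)
proof (induction I)
  case empty
  then show ?case by (simp add: transfer_def)
next
  case (insert i I)
  then show ?case using transfer_add[OF _ admissible_sum, of s "f i" I f x] assms(3) by auto
qed

lemma sum_bounded_average:
  fixes u :: "nat \<Rightarrow> real"
  assumes "\<And>j. m \<le> u j" "\<And>j. u j \<le> C"
  shows "m \<le> (\<Sum>j\<le>N. u j) / real (Suc N)" "(\<Sum>j\<le>N. u j) / real (Suc N) \<le> C"
  using sum_bounded_below[of "{..N}" m u] sum_bounded_above[of "{..N}" u C] assms
  by (simp_all add: pos_le_divide_eq pos_divide_le_eq mult.commute)

text \<open>The averages are uniformly bounded and equicontinuous, so a subsequence converges
  uniformly, and each average is an eigenfunction up to \<open>O(1/N)\<close>. The subsequence is
  part of the conclusion because the corrector is built from averages of \<open>b\<close> close to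
  \<open>F\<close>.\<close>

theorem average_subsequence_limit:
  assumes "s > 1/2" "0 \<le> M" "log_lip M b"
  obtains F r where "log_lip (2 * s + M) F" "strict_mono (r :: nat \<Rightarrow> nat)"
    "\<And>x. x \<in> {0..1} \<Longrightarrow> transfer s F x = exp (pressure s) * F x"
    "\<And>e. 0 < e \<Longrightarrow> \<exists>N. \<forall>n\<ge>N. \<forall>x\<in>{0..1}. \<bar>average s b (r n) x - F x\<bar> < e"
proof -
  define l where "l = exp (pressure s)"
  have l: "0 < l" unfolding l_def by simp
  have M': "0 \<le> 2 * s + M" using assms by simp
  define A where "A = average s b"
  obtain m C where m: "0 < m" and it: "\<And>j x. x \<in> {0..1} \<Longrightarrow> m \<le> iterate s j b x / l ^ j"
    "\<And>j x. x \<in> {0..1} \<Longrightarrow> iterate s j b x / l ^ j \<le> C"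
    using iterate_scaled_bounds[OF assms] unfolding l_def by metis
  have A: "m \<le> A N x" "A N x \<le> C" if "x \<in> {0..1}" for N x
    unfolding A_def average_alt l_def[symmetric]
    using sum_bounded_average[of m "\<lambda>j. iterate s j b x / l ^ j" C N] it[OF that] by blast+
  have summand: "log_lip (2 * s + M) (\<lambda>x. 1 / (real (Suc N) * l ^ j) * iterate s j b x)" for N j
    by (intro log_lip_cmult iterate_log_lip assms) (use l in auto)
  have A_lip: "log_lip (2 * s + M) (A N)" for N
    unfolding A_def average_def l_def[symmetric] by (intro log_lip_sum summand) auto
  \<comment> \<open>Telescoping: applying the operator shifts the normalised iterates by one, so
    only the first and the last survive.\<close>
  have A_transfer: "transfer s (A N) x - l * A N x = l * (iterate s (Suc N) b x / l ^ Suc N - b x) / real (Suc N)"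
    if x: "x \<in> {0..1}" for N x
  proof -
    have "transfer s (A N) x = (\<Sum>j\<le>N. transfer s (\<lambda>x. 1 / (real (Suc N) * l ^ j) * iterate s j b x) x)"
      unfolding A_def average_def l_def[symmetric]
      by (rule transfer_sum) (use log_lip_admissible[OF assms(1) M' summand] x in auto)
    also have "\<dots> = (\<Sum>j\<le>N. 1 / (real (Suc N) * l ^ j) * iterate s (Suc j) b x)"
      unfolding transfer_cmult by simp
    also have "\<dots> = (\<Sum>j\<le>N. l / real (Suc N) * (iterate s (Suc j) b x / l ^ Suc j))"
      using l by (intro sum.cong) auto
    also have "\<dots> = l / real (Suc N) * (\<Sum>j\<le>N. iterate s (Suc j) b x / l ^ Suc j)"
      by (rule sum_distrib_left[symmetric])
    moreover have "l * A N x = l / real (Suc N) * (\<Sum>j\<le>N. iterate s j b x / l ^ j)"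
      unfolding A_def average_alt l_def[symmetric] by simp
    ultimately have "transfer s (A N) x - l * A N x
        = l / real (Suc N) * (\<Sum>j\<le>N. iterate s (Suc j) b x / l ^ Suc j - iterate s j b x / l ^ j)"
      by (simp only: sum_subtractf right_diff_distrib)
    also have "(\<Sum>j\<le>N. iterate s (Suc j) b x / l ^ Suc j - iterate s j b x / l ^ j)
        = iterate s (Suc N) b x / l ^ Suc N - b x"
      by (induction N) auto
    finally show ?thesis by simp
  qed
  obtain F r where F: "continuous_on {0..1} F" "strict_mono (r :: nat \<Rightarrow> nat)"
    "\<And>e. 0 < e \<Longrightarrow> \<exists>N. \<forall>n x. n \<ge> N \<and> x \<in> {0..1} \<longrightarrow> norm (A (r n) x - F x) < e"
  proof (rule Arzela_Ascoli[of "{0..1::real}" A C])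
    show "norm (A n x) \<le> C" if "x \<in> {0..1}" for n x using A[OF that, of n] m by simp
    show "\<exists>d. 0 < d \<and> (\<forall>n y. y \<in> {0..1} \<and> norm (x - y) < d \<longrightarrow> norm (A n x - A n y) < e)"
      if x: "x \<in> {0..1}" and e: "0 < e" for x e :: real
    proof -
      obtain d where "0 < d" "\<And>f x y. log_lip (2 * s + M) f \<Longrightarrow> (\<And>x. x \<in> {0..1} \<Longrightarrow> f x \<le> C) \<Longrightarrow>
          x \<in> {0..1} \<Longrightarrow> y \<in> {0..1} \<Longrightarrow> \<bar>x - y\<bar> < d \<Longrightarrow> \<bar>f x - f y\<bar> < e"
        using log_lip_equicontinuous[OF M' e] by metis
      then show ?thesis using A_lip A(2) x unfolding real_norm_def by blast
    qed
  qed auto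
  have unif: "\<exists>N. \<forall>n\<ge>N. \<forall>x\<in>{0..1}. \<bar>A (r n) x - F x\<bar> < e" if "0 < e" for e
    using F(3)[OF that] unfolding real_norm_def by blast
  have lim: "(\<lambda>n. A (r n) x) \<longlonglongrightarrow> F x" if "x \<in> {0..1}" for x
    unfolding LIMSEQ_def dist_real_def using unif that by blast
  have F_ge: "m \<le> F x" if "x \<in> {0..1}" for x
    by (rule LIMSEQ_le_const[OF lim[OF that]]) (use A that in auto)
  have F_le: "F x \<le> C" if "x \<in> {0..1}" for x
    by (rule LIMSEQ_le_const2[OF lim[OF that]]) (use A that in auto)
  have F_lip: "log_lip (2 * s + M) F"
    unfolding log_lip_def
  proof (intro conjI ballI)
    fix x y :: real assume "x \<in> {0..1}" "y \<in> {0..1}"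
    then show "F x \<le> exp ((2 * s + M) * \<bar>x - y\<bar>) * F y"
      by (intro LIMSEQ_le[OF lim tendsto_mult_left[OF lim]]) (use log_lipD[OF A_lip] in auto)
  qed (use F_ge m in force)
  have eigen: "transfer s F x = l * F x" if x: "x \<in> {0..1}" for x
  proof -
    have adm: "admissible s F" "admissible s (A N)" for N
      using log_lip_admissible[OF assms(1) M'] F_lip A_lip by auto
    have T: "(\<lambda>n. transfer s (A (r n)) x) \<longlonglongrightarrow> transfer s F x"
      unfolding LIMSEQ_def dist_real_def
    proof (intro allI impI)
      fix e :: real assume e: "0 < e"
      \<comment> \<open>\<open>K\<close> bounds the operator in the supremum norm, so uniform
        convergence passes through it.\<close>
      define K where "K = transfer s (\<lambda>_. 1) 0"
      have K: "0 < K" unfolding K_def using transfer_one_bounds(1)[OF assms(1)] by simp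
      have "0 < e / (2 * K)" using e K by simp
      then obtain N where N: "\<And>n x. n \<ge> N \<Longrightarrow> x \<in> {0..1} \<Longrightarrow> \<bar>A (r n) x - F x\<bar> < e / (2 * K)"
        using unif by blast
      have "\<bar>transfer s (A (r n)) x - transfer s F x\<bar> < e" if n: "n \<ge> N" for n
      proof -
        have "\<bar>transfer s (\<lambda>y. A (r n) y - F y) x\<bar> \<le> e / (2 * K) * K"
          unfolding K_def by (rule transfer_bounded[OF assms(1) _ x]) (use N[OF n] in \<open>auto simp: K_def intro: less_imp_le\<close>)
        also have "\<dots> < e" using e K by simp
        finally show ?thesis using transfer_diff[OF adm(2) adm(1) x] by simp
      qed
      then show "\<exists>N. \<forall>n\<ge>N. \<bar>transfer s (A (r n)) x - transfer s F x\<bar> < e" by blast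
    qed
    have "(\<lambda>n. transfer s (A (r n)) x - l * A (r n) x) \<longlonglongrightarrow> 0"
    proof (rule Lim_null_comparison)
      show "\<forall>\<^sub>F n in sequentially. norm (transfer s (A (r n)) x - l * A (r n) x) \<le> l * C / real n"
        using eventually_gt_at_top[of 0]
      proof eventually_elim
        case (elim n)
        have 1: "\<bar>iterate s (Suc (r n)) b x / l ^ Suc (r n) - b x\<bar> \<le> C"
          using it[OF x, of "Suc (r n)"] it[OF x, of 0] m by (simp del: power_Suc funpow.simps add: abs_le_iff)
        have "norm (transfer s (A (r n)) x - l * A (r n) x)
            = l * \<bar>iterate s (Suc (r n)) b x / l ^ Suc (r n) - b x\<bar> / real (Suc (r n))"
          unfolding A_transfer[OF x] using l by (simp add: abs_mult abs_divide del: power_Suc funpow.simps)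
        also have "\<dots> \<le> l * C / real n"
          using 1 l m elim seq_suble[OF F(2), of n] by (intro frac_le mult_left_mono mult_nonneg_nonneg) auto
        finally show ?case .
      qed
      show "(\<lambda>n. l * C / real n) \<longlonglongrightarrow> 0" by (rule lim_const_over_n)
    qed
    then have "transfer s F x - l * F x = 0"
      using LIMSEQ_unique[OF tendsto_diff[OF T tendsto_mult_left[OF lim[OF x], of l]]] by simp
    then show ?thesis by simp
  qed
  show ?thesis
    by (rule that[OF F_lip F(2)]) (use eigen unif in \<open>auto simp: l_def A_def\<close>)
qed

lemma eigenfunction_exists:
  assumes "s > 1/2"
  obtains h where "log_lip (2 * s) h" "\<And>x. x \<in> {0..1} \<Longrightarrow> transfer s h x = exp (pressure s) * h x"
proof -
  obtain F and r :: "nat \<Rightarrow> nat" where "log_lip (2 * s + 0) F"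
    "\<And>x. x \<in> {0..1} \<Longrightarrow> transfer s F x = exp (pressure s) * F x"
    by (rule average_subsequence_limit[OF assms order_refl log_lip_one]) blast
  then show ?thesis using that[of F] by simp
qed

text \<open>Maximum principle: at a maximum \<open>x\<close> of \<open>F / h\<close> the quotient takes the same value at all the
  points \<open>1 / (a + x)\<close>, hence at their limit \<open>0\<close>. The same holds for the minimum.\<close>

lemma eigenfunction_le:
  assumes "s > 1/2" "0 \<le> M" "log_lip M F" "0 \<le> M'" "log_lip M' h"
    "\<And>x. x \<in> {0..1} \<Longrightarrow> transfer s F x = l * F x" "\<And>x. x \<in> {0..1} \<Longrightarrow> transfer s h x = l * h x"
    "x \<in> {0..1}"
  shows "F x \<le> F 0 / h 0 * h x"
proof -
  have cont: "continuous_on {0..1} F" "continuous_on {0..1} h"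
    using log_lip_continuous assms by blast+
  have hpos: "0 < h y" if "y \<in> {0..1}" for y using log_lip_pos[OF assms(5) that] .
  have "continuous_on {0..1} (\<lambda>x. F x / h x)"
    using cont hpos by (intro continuous_on_divide) force+
  then obtain z where z: "z \<in> {0..1}" "\<And>y. y \<in> {0..1} \<Longrightarrow> F y / h y \<le> F z / h z"
    using continuous_attains_sup[of "{0..1::real}" "\<lambda>x. F x / h x"] by auto
  define q where "q = F z / h z"
  have q: "F y \<le> q * h y" if "y \<in> {0..1}" for y
    using z(2)[OF that] hpos[OF that] unfolding q_def[symmetric] by (simp add: pos_divide_le_eq)
  have adm: "admissible s (\<lambda>y. q * h y)" "admissible s F"
    using admissible_cmult log_lip_admissible[OF assms(1)] assms by auto
  have adm': "admissible s (\<lambda>y. q * h y - F y)"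
    using admissible_add[OF adm(1) admissible_cmult[OF adm(2), of "-1"]] by simp
  have "transfer s (\<lambda>y. q * h y - F y) z = l * (q * h z - F z)"
    using transfer_diff[OF adm z(1)] transfer_cmult[of s q h z] assms(6,7)[OF z(1)]
    by (simp add: algebra_simps)
  also have "\<dots> = 0" unfolding q_def using hpos[OF z(1)] by simp
  finally have T: "transfer s (\<lambda>y. q * h y - F y) z = 0" .
  \<comment> \<open>A nonnegative family with sum \<open>0\<close> vanishes term by term, and the
    weights are positive.\<close>
  have eq: "q * h (1 / (real a + z)) - F (1 / (real a + z)) = 0" if a: "a \<ge> 1" for a :: nat
  proof -
    have "(1 / (real a + z)) powr (2 * s) * (q * h (1 / (real a + z)) - F (1 / (real a + z))) = 0"
      by (rule nonneg_has_sum_le_0D[OF transfer_has_sum[OF adm' z(1)]])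
        (use T a q inverse_add_unit(2)[OF z(1)] in auto)
    then show ?thesis using inverse_add_unit(1)[OF z(1) a] by auto
  qed
  have lim: "(\<lambda>a. 1 / (real (Suc a) + z)) \<longlonglongrightarrow> 0"
  proof (rule Lim_null_comparison)
    show "\<forall>\<^sub>F a in sequentially. norm (1 / (real (Suc a) + z)) \<le> 1 / real (Suc a)"
      using z(1) by (intro always_eventually) (auto intro!: frac_le)
    show "(\<lambda>a. 1 / real (Suc a)) \<longlonglongrightarrow> 0" using LIMSEQ_inverse_real_of_nat by (simp add: inverse_eq_divide)
  qed
  have "continuous_on {0..1} (\<lambda>y. q * h y - F y)" using cont by (intro continuous_intros)
  then have "(\<lambda>a. q * h (1 / (real (Suc a) + z)) - F (1 / (real (Suc a) + z))) \<longlonglongrightarrow> q * h 0 - F 0"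
    by (rule continuous_on_tendsto_compose[OF _ lim])
      (use inverse_add_unit(2)[OF z(1)] in \<open>simp_all del: of_nat_Suc\<close>)
  then have "q * h 0 - F 0 = 0" 
    unfolding eq[OF Suc_le_mono[THEN iffD2, OF le0, folded One_nat_def]] using LIMSEQ_unique[OF tendsto_const] by metis
  then have "q = F 0 / h 0" using hpos[of 0] by (simp add: field_simps)
  then show ?thesis using q[OF assms(8)] by simp
qed

text \<open>Exchanging \<open>F\<close> and \<open>h\<close> in \<open>eigenfunction_le\<close>
  gives the reverse inequality.\<close>

lemma eigenfunction_unique:
  assumes "s > 1/2" "0 \<le> M" "log_lip M F" "0 \<le> M'" "log_lip M' h"
    "\<And>x. x \<in> {0..1} \<Longrightarrow> transfer s F x = l * F x" "\<And>x. x \<in> {0..1} \<Longrightarrow> transfer s h x = l * h x"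
    "x \<in> {0..1}"
  shows "F x = F 0 / h 0 * h x"
  using eigenfunction_le[OF assms] eigenfunction_le[of s M' h M F l x] assms
    log_lip_pos[OF assms(3), of 0] log_lip_pos[OF assms(5), of 0]
  by (auto simp: field_simps)

text \<open>An approximate Poisson equation. An average of \<open>b\<close> is \<open>b\<close> plus
  the image of an explicit \<open>k\<close> under the operator minus
  \<open>exp (pressure s)\<close>; along the subsequence the averages tend to an eigenfunction,
  which by uniqueness is a multiple \<open>c\<close> of \<open>h\<close>. The number
  \<open>c\<close> does not depend on \<open>e\<close>.\<close>

lemma corrector_exists:
  assumes "s > 1/2" "0 \<le> M" "log_lip M b" "0 \<le> M'" "log_lip M' h"
    "\<And>x. x \<in> {0..1} \<Longrightarrow> transfer s h x = exp (pressure s) * h x"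
  obtains c where "\<And>e. 0 < e \<Longrightarrow> \<exists>k K. (\<forall>x\<in>{0..1}. 0 \<le> k x \<and> k x \<le> K) \<and>
    (\<forall>x\<in>{0..1}. \<bar>transfer s k x + b x - exp (pressure s) * k x - c * h x\<bar> \<le> e)"
proof -
  define l where "l = exp (pressure s)"
  have l: "0 < l" unfolding l_def by simp
  have M2: "0 \<le> 2 * s + M" using assms by simp
  obtain F r where F: "log_lip (2 * s + M) F" "strict_mono (r :: nat \<Rightarrow> nat)"
    "\<And>x. x \<in> {0..1} \<Longrightarrow> transfer s F x = exp (pressure s) * F x"
    "\<And>e. 0 < e \<Longrightarrow> \<exists>N. \<forall>n\<ge>N. \<forall>x\<in>{0..1}. \<bar>average s b (r n) x - F x\<bar> < e"
    using average_subsequence_limit[OF assms(1-3)] by metis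
  have FH: "F x = F 0 / h 0 * h x" if "x \<in> {0..1}" for x
    by (rule eigenfunction_unique[OF assms(1) M2 F(1) assms(4,5) F(3) assms(6) that])
  show ?thesis
  proof (rule that[of "F 0 / h 0"])
    fix e :: real assume "0 < e"
    then obtain n where n: "\<And>x. x \<in> {0..1} \<Longrightarrow> \<bar>average s b (r n) x - F x\<bar> < e"
      using F(4) by blast
    define N where "N = r n"
    \<comment> \<open>With the exponent \<open>Suc i\<close>, the operator minus \<open>l\<close>
      maps \<open>u i\<close> to the difference of two consecutive normalised iterates over
      \<open>Suc N\<close>. Summing over \<open>i < j\<close> telescopes to iterate \<open>j\<close>
      minus \<open>b\<close>, and summing over \<open>j\<close> gives the average minus
      \<open>b\<close>.\<close>
    define u where "u i x = 1 / (real (Suc N) * l ^ Suc i) * iterate s i b x" for i x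
    define k where "k x = (\<Sum>j\<le>N. \<Sum>i<j. u i x)" for x
    have u_lip: "log_lip (2 * s + M) (u i)" for i
      unfolding u_def by (intro log_lip_cmult iterate_log_lip assms) (use l in auto)
    have u_adm: "admissible s (u i)" for i by (rule log_lip_admissible[OF assms(1) M2 u_lip])
    have k_bd: "0 \<le> k x \<and> k x \<le> (\<Sum>j\<le>N. \<Sum>i<j. exp (2 * s + M) * u i 0)" if "x \<in> {0..1}" for x
      unfolding k_def using log_lip_pos[OF u_lip that] log_lip_le[OF u_lip M2 that, of 0]
      by (auto intro!: sum_nonneg sum_mono intro: less_imp_le)
    have k_eq: "transfer s k x + b x - l * k x = average s b N x" if x: "x \<in> {0..1}" for x
    proof -
      have "transfer s k x = (\<Sum>j\<le>N. transfer s (\<lambda>x. \<Sum>i<j. u i x) x)"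
        unfolding k_def by (rule transfer_sum) (use x u_adm in \<open>auto intro!: admissible_sum\<close>)
      also have "\<dots> = (\<Sum>j\<le>N. \<Sum>i<j. transfer s (u i) x)"
        by (intro sum.cong transfer_sum) (use x u_adm in auto)
      finally have "transfer s k x - l * k x = (\<Sum>j\<le>N. \<Sum>i<j. transfer s (u i) x - l * u i x)"
        unfolding k_def by (simp add: sum_subtractf sum_distrib_left)
      also have "\<dots> = (\<Sum>j\<le>N. (iterate s j b x / l ^ j - b x) / real (Suc N))"
      proof (rule sum.cong[OF refl])
        fix j
        have t: "transfer s (u i) x - l * u i x
            = iterate s (Suc i) b x / l ^ Suc i / real (Suc N) - iterate s i b x / l ^ i / real (Suc N)" for i
        proof -
          have "transfer s (u i) x = 1 / (real (Suc N) * l ^ Suc i) * iterate s (Suc i) b x"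
            unfolding u_def transfer_cmult by simp
          then show ?thesis unfolding u_def using l by (simp add: mult_ac del: of_nat_Suc)
        qed
        show "(\<Sum>i<j. transfer s (u i) x - l * u i x) = (iterate s j b x / l ^ j - b x) / real (Suc N)"
          unfolding t by (induction j) (simp_all add: diff_divide_distrib del: of_nat_Suc)
      qed
      also have "\<dots> = average s b N x - b x"
        unfolding average_alt l_def[symmetric]
        by (simp only: sum_divide_distrib[symmetric] sum_subtractf) (simp add: diff_divide_distrib)
      finally show ?thesis by simp
    qed
    have "\<bar>transfer s k x + b x - l * k x - F 0 / h 0 * h x\<bar> \<le> e" if "x \<in> {0..1}" for x
      using n[OF that] FH[OF that] unfolding k_eq[OF that] N_def by simp
    then show "\<exists>k K. (\<forall>x\<in>{0..1}. 0 \<le> k x \<and> k x \<le> K) \<and>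
        (\<forall>x\<in>{0..1}. \<bar>transfer s k x + b x - exp (pressure s) * k x - F 0 / h 0 * h x\<bar> \<le> e)"
      using k_bd unfolding l_def by blast
  qed
qed

section \<open>Strict convexity\<close>

text \<open>Cauchy-Schwarz for the families \<open>A\<close> and \<open>B\<close>, proved as a
  termwise weighted inequality of arithmetic and geometric means. Equality would force
  \<open>B a / A a\<close> to be constant, but it tends to \<open>0\<close> for large letters
  because \<open>s1 < s2\<close>.\<close>

lemma transfer_geometric_mean_less:
  assumes s: "s1 > 1/2" "s2 > 1/2" "s1 < s2"
    and h1: "0 \<le> M1" "log_lip M1 h1" "\<And>x. x \<in> {0..1} \<Longrightarrow> transfer s1 h1 x = l1 * h1 x"
    and h2: "0 \<le> M2" "log_lip M2 h2" "\<And>x. x \<in> {0..1} \<Longrightarrow> transfer s2 h2 x = l2 * h2 x"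
    and l: "0 < l1" "0 < l2" and x: "x \<in> {0..1}"
    and adm: "admissible ((s1 + s2) / 2) (\<lambda>y. sqrt (h1 y * h2 y))"
  shows "transfer ((s1 + s2) / 2) (\<lambda>y. sqrt (h1 y * h2 y)) x < sqrt (l1 * l2) * sqrt (h1 x * h2 x)"
proof -
  define y where "y a = 1 / (real a + x)" for a :: nat
  define A where "A a = y a powr (2 * s1) * h1 (y a)" for a
  define B where "B a = y a powr (2 * s2) * h2 (y a)" for a
  have y: "y a \<in> {0<..1}" "y a \<in> {0..1}" if "a \<in> {1..}" for a
    using inverse_add_unit[OF x, of a] that unfolding y_def by auto
  have pos: "0 < A a" "0 < B a" if "a \<in> {1..}" for a
    using y[OF that] log_lip_pos[OF h1(2) y(2)[OF that]] log_lip_pos[OF h2(2) y(2)[OF that]]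
    unfolding A_def B_def by auto
  define \<alpha> where "\<alpha> = sqrt (l1 * h1 x)"
  define \<beta> where "\<beta> = sqrt (l2 * h2 x)"
  have hx: "0 < h1 x" "0 < h2 x" using log_lip_pos h1 h2 x by blast+
  have \<alpha>: "0 < \<alpha>" "0 < \<beta>" "l1 * h1 x = \<alpha> * \<alpha>" "l2 * h2 x = \<beta> * \<beta>"
    unfolding \<alpha>_def \<beta>_def using l hx by auto
  have sA: "(A has_sum \<alpha> * \<alpha>) {1..}"
    using transfer_has_sum[OF log_lip_admissible[OF s(1) h1(1,2)] x] h1(3)[OF x] \<alpha>(3)
    unfolding A_def y_def by simp
  have sB: "(B has_sum \<beta> * \<beta>) {1..}"
    using transfer_has_sum[OF log_lip_admissible[OF s(2) h2(1,2)] x] h2(3)[OF x] \<alpha>(4)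
    unfolding B_def y_def by simp
  \<comment> \<open>The two coefficients are chosen so that each half sums to
    \<open>\<alpha> * \<beta> / 2\<close>.\<close>
  have sAB: "((\<lambda>a. \<beta> / (2 * \<alpha>) * A a + \<alpha> / (2 * \<beta>) * B a) has_sum \<alpha> * \<beta>) {1..}"
    using has_sum_add[OF has_sum_cmult_right[OF sA, of "\<beta> / (2 * \<alpha>)"] has_sum_cmult_right[OF sB, of "\<alpha> / (2 * \<beta>)"]] \<alpha>
    by (simp add: field_simps)
  have summand: "y a powr (2 * ((s1 + s2) / 2)) * sqrt (h1 (y a) * h2 (y a)) = sqrt (A a * B a)"
    if a: "a \<in> {1..}" for a
  proof -
    have "(y a powr (s1 + s2))\<^sup>2 = y a powr (2 * s1) * y a powr (2 * s2)"
      by (simp add: power2_eq_square powr_add[symmetric] algebra_simps)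
    then have "A a * B a = (y a powr (s1 + s2))\<^sup>2 * (h1 (y a) * h2 (y a))"
      unfolding A_def B_def by (simp add: mult_ac)
    moreover have "2 * ((s1 + s2) / 2) = s1 + s2" by simp
    ultimately show ?thesis by (simp only: real_sqrt_mult real_sqrt_abs abs_of_nonneg[OF powr_ge_zero])
  qed
  have sF: "((\<lambda>a. sqrt (A a * B a)) has_sum transfer ((s1 + s2) / 2) (\<lambda>y. sqrt (h1 y * h2 y)) x) {1..}"
    using transfer_has_sum[OF adm x] summand
    by (subst has_sum_cong[where g = "\<lambda>a. y a powr (2 * ((s1 + s2) / 2)) * sqrt (h1 (y a) * h2 (y a))"])
      (auto simp: y_def)
  have prod: "A a * B a = (\<beta> / \<alpha> * A a) * (\<alpha> / \<beta> * B a)" for a using \<alpha> by simp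
  have le: "sqrt (A a * B a) \<le> \<beta> / (2 * \<alpha>) * A a + \<alpha> / (2 * \<beta>) * B a" if "a \<in> {1..}" for a
    using arith_geo_mean_sqrt[of "\<beta> / \<alpha> * A a" "\<alpha> / \<beta> * B a"] pos[OF that] \<alpha>(1,2)
    unfolding prod[of a] by (simp add: field_simps)
  obtain m1 C1 where m1: "0 < m1" "\<And>x. x \<in> {0..1} \<Longrightarrow> m1 \<le> h1 x"
    using log_lip_bounded[OF h1(2,1)] by metis
  obtain m2 C2 where C2: "0 < m2" "m2 \<le> C2" "\<And>x. x \<in> {0..1} \<Longrightarrow> h2 x \<le> C2"
    using log_lip_bounded[OF h2(2,1)] by metis
  \<comment> \<open>A letter is sought with \<open>B a / A a\<close> below
    \<open>\<beta>\<^sup>2 / \<alpha>\<^sup>2\<close>, where the two means differ; the constants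
    \<open>m1\<close> and \<open>C2\<close> absorb the eigenfunctions.\<close>
  have "filterlim (\<lambda>a. x + real a) at_top sequentially"
    by (rule filterlim_tendsto_add_at_top[OF tendsto_const filterlim_real_sequentially])
  then have "(\<lambda>a. (x + real a) powr (- (2 * (s2 - s1)))) \<longlonglongrightarrow> 0"
    by (rule tendsto_neg_powr[rotated]) (use s in simp)
  moreover have "(x + real a) powr (- d) = y a powr d" for a d
    using x unfolding y_def by (simp add: powr_minus_divide powr_divide add.commute)
  ultimately have "(\<lambda>a. y a powr (2 * (s2 - s1))) \<longlonglongrightarrow> 0" by (simp only:)
  moreover have "0 < \<beta> * \<beta> * m1 / (\<alpha> * \<alpha> * C2)" using \<alpha> m1 C2 by simp
  ultimately have "\<forall>\<^sub>F a in sequentially. y a powr (2 * (s2 - s1)) < \<beta> * \<beta> * m1 / (\<alpha> * \<alpha> * C2)"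
    by (rule order_tendstoD(2))
  then have "\<forall>\<^sub>F a in sequentially. 1 \<le> a \<and> y a powr (2 * (s2 - s1)) < \<beta> * \<beta> * m1 / (\<alpha> * \<alpha> * C2)"
    using eventually_ge_at_top[of 1] by eventually_elim simp
  then obtain a where a: "a \<in> {1..}" "y a powr (2 * (s2 - s1)) < \<beta> * \<beta> * m1 / (\<alpha> * \<alpha> * C2)"
    by (auto simp: eventually_sequentially)
  have "\<alpha> * \<alpha> * B a \<le> \<alpha> * \<alpha> * (y a powr (2 * s2) * C2)"
    unfolding B_def using C2(3)[OF y(2)[OF a(1)]] \<alpha> by (intro mult_left_mono) auto
  also have "\<dots> = y a powr (2 * s1) * (\<alpha> * \<alpha> * C2 * y a powr (2 * (s2 - s1)))"
    by (simp add: mult_ac powr_add[symmetric] right_diff_distrib)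
  also have "\<dots> < y a powr (2 * s1) * (\<beta> * \<beta> * m1)"
    using a(2) \<alpha> C2 y(1)[OF a(1)] by (intro mult_strict_left_mono) (auto simp: field_simps)
  also have "\<dots> \<le> \<beta> * \<beta> * A a"
    unfolding A_def using m1(2)[OF y(2)[OF a(1)]] \<alpha> by (simp add: mult_ac mult_right_mono)
  finally have ne: "\<beta> / \<alpha> * A a \<noteq> \<alpha> / \<beta> * B a" using \<alpha>(1,2) by (auto simp: field_simps)
  have "sqrt (A a * B a) \<noteq> \<beta> / (2 * \<alpha>) * A a + \<alpha> / (2 * \<beta>) * B a"
  proof
    let ?u = "\<beta> / \<alpha> * A a" and ?v = "\<alpha> / \<beta> * B a"
    assume "sqrt (A a * B a) = \<beta> / (2 * \<alpha>) * A a + \<alpha> / (2 * \<beta>) * B a"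
    then have e: "sqrt (?u * ?v) = (?u + ?v) / 2" unfolding prod[of a] by (simp add: add_divide_distrib)
    have "0 < ?u * ?v" using pos[OF a(1)] \<alpha>(1,2) by simp
    then have "?u * ?v = (sqrt (?u * ?v))\<^sup>2" by simp
    then have "?u * ?v = ((?u + ?v) / 2)\<^sup>2" unfolding e .
    then have "(?u - ?v)\<^sup>2 = 0" by (simp add: power2_eq_square algebra_simps)
    then show False using ne by simp
  qed
  then have "sqrt (A a * B a) < \<beta> / (2 * \<alpha>) * A a + \<alpha> / (2 * \<beta>) * B a" using le[OF a(1)] by simp
  from has_sum_strict_mono[OF sF sAB le a(1) this]
  have "transfer ((s1 + s2) / 2) (\<lambda>y. sqrt (h1 y * h2 y)) x < \<alpha> * \<beta>" .
  also have "\<alpha> * \<beta> = sqrt (l1 * l2) * sqrt (h1 x * h2 x)"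
    unfolding \<alpha>_def \<beta>_def by (simp add: real_sqrt_mult)
  finally show ?thesis .
qed

text \<open>The geometric mean \<open>f\<close> of the two eigenfunctions is a pointwise strict
  supersolution at the midpoint. The quotient \<open>transfer s f x / f x\<close> attains its
  maximum on \<open>{0..1}\<close>, so one factor \<mu> stays strictly below the geometric mean of
  the eigenvalues.\<close>

theorem pressure_midpoint_strict:
  assumes "s1 > 1/2" "s1 < s2"
  shows "pressure ((s1 + s2) / 2) < (pressure s1 + pressure s2) / 2"
proof -
  have s2: "s2 > 1/2" using assms by simp
  define s where "s = (s1 + s2) / 2"
  have s: "s > 1/2" unfolding s_def using assms by simp
  obtain h1 where h1: "log_lip (2 * s1) h1" "\<And>x. x \<in> {0..1} \<Longrightarrow> transfer s1 h1 x = exp (pressure s1) * h1 x"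
    using eigenfunction_exists[OF assms(1)] by metis
  obtain h2 where h2: "log_lip (2 * s2) h2" "\<And>x. x \<in> {0..1} \<Longrightarrow> transfer s2 h2 x = exp (pressure s2) * h2 x"
    using eigenfunction_exists[OF s2] by metis
  have M: "0 \<le> 2 * s1" "0 \<le> 2 * s2" "0 \<le> 2 * s" "0 \<le> 2 * s + 2 * s" using assms s2 s by auto
  define f where "f y = sqrt (h1 y * h2 y)" for y
  have f: "log_lip (2 * s) f"
    unfolding log_lip_def
  proof (intro conjI ballI)
    fix x y :: real assume x: "x \<in> {0..1}" and y: "y \<in> {0..1}"
    define E where "E = exp (2 * s * \<bar>x - y\<bar>)"
    have E: "E\<^sup>2 = exp (2 * s1 * \<bar>x - y\<bar>) * exp (2 * s2 * \<bar>x - y\<bar>)" "0 < E"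
      unfolding E_def s_def by (simp_all add: power2_eq_square exp_add[symmetric] algebra_simps)
    have "h1 x * h2 x \<le> (exp (2 * s1 * \<bar>x - y\<bar>) * h1 y) * (exp (2 * s2 * \<bar>x - y\<bar>) * h2 y)"
      using log_lipD[OF h1(1) x y] log_lipD[OF h2(1) x y] log_lip_pos[OF h1(1) x] log_lip_pos[OF h2(1) x]
        log_lip_pos[OF h1(1) y] by (intro mult_mono) auto
    also have "\<dots> = E\<^sup>2 * (h1 y * h2 y)" unfolding E by (simp add: mult_ac)
    finally have "f x \<le> sqrt (E\<^sup>2 * (h1 y * h2 y))" unfolding f_def by (rule real_sqrt_le_mono)
    also have "\<dots> = E * f y" unfolding f_def using E(2) by (simp add: real_sqrt_mult)
    finally show "f x \<le> exp (2 * s * \<bar>x - y\<bar>) * f y" unfolding E_def .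
  qed (use log_lip_pos[OF h1(1)] log_lip_pos[OF h2(1)] in \<open>auto simp: f_def\<close>)
  have Tf: "log_lip (2 * s + 2 * s) (transfer s f)" by (rule transfer_log_lip[OF s M(3) f])
  have "continuous_on {0..1} (\<lambda>x. transfer s f x / f x)"
    using log_lip_continuous[OF Tf M(4)] log_lip_continuous[OF f M(3)] log_lip_pos[OF f]
    by (intro continuous_on_divide) force+
  then obtain z where z: "z \<in> {0..1}" "\<And>y. y \<in> {0..1} \<Longrightarrow> transfer s f y / f y \<le> transfer s f z / f z"
    using continuous_attains_sup[of "{0..1::real}" "\<lambda>x. transfer s f x / f x"] by auto
  define \<mu> where "\<mu> = transfer s f z / f z"
  have fz: "0 < f z" "0 < transfer s f z" using log_lip_pos f Tf z(1) by blast+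
  have \<mu>: "0 < \<mu>" unfolding \<mu>_def using fz by simp
  have "transfer s f z < sqrt (exp (pressure s1) * exp (pressure s2)) * f z"
    unfolding s_def f_def
    by (rule transfer_geometric_mean_less[OF assms(1) s2 assms(2) M(1) h1 M(2) h2 _ _ z(1)])
      (use log_lip_admissible[OF s M(3) f] in \<open>simp_all add: s_def f_def[abs_def]\<close>)
  then have lt: "\<mu> < sqrt (exp (pressure s1) * exp (pressure s2))"
    unfolding \<mu>_def using fz(1) by (simp add: pos_divide_less_eq)
  obtain m C where mC: "0 < m" "\<And>x. x \<in> {0..1} \<Longrightarrow> m \<le> f x" "\<And>x. x \<in> {0..1} \<Longrightarrow> f x \<le> C"
    using log_lip_bounded[OF f M(3)] by metis
  have "pressure s \<le> ln \<mu>"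
  proof (rule pressure_le_if_supersolution[OF s mC(1) \<mu> mC(2,3)])
    fix x :: real assume x: "x \<in> {0..1}"
    show "transfer s f x \<le> \<mu> * f x"
      using z(2)[OF x] log_lip_pos[OF f x] unfolding \<mu>_def[symmetric] by (simp add: pos_divide_le_eq)
  qed
  also have "ln \<mu> < ln (sqrt (exp (pressure s1) * exp (pressure s2)))" using lt \<mu> by simp
  also have "\<dots> = (pressure s1 + pressure s2) / 2"
    by (simp add: ln_sqrt exp_add[symmetric])
  finally show ?thesis unfolding s_def .
qed

section \<open>Differentiability\<close>

lemma log_lip_mult:
  assumes "log_lip M f" "log_lip M' g"
  shows "log_lip (M + M') (\<lambda>x. f x * g x)"
  unfolding log_lip_def
proof (intro conjI ballI)
  fix x y :: real assume x: "x \<in> {0..1}" and y: "y \<in> {0..1}"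
  have "f x * g x \<le> (exp (M * \<bar>x - y\<bar>) * f y) * (exp (M' * \<bar>x - y\<bar>) * g y)"
    using log_lipD[OF assms(1) x y] log_lipD[OF assms(2) x y] log_lip_pos[OF assms(2) x]
      log_lip_pos[OF assms(1) y] by (intro mult_mono) auto
  then show "f x * g x \<le> exp ((M + M') * \<bar>x - y\<bar>) * (f y * g y)"
    unfolding distrib_right exp_add by (simp only: mult_ac)
qed (use log_lip_pos[OF assms(1)] log_lip_pos[OF assms(2)] in auto)

lemma admissible_shift:
  assumes "admissible (s - r) f"
  shows "admissible s (\<lambda>y. y powr - (2 * r) * f y)"
  using assms unfolding admissible_def
  by (simp add: mult.assoc[symmetric] powr_add[symmetric] right_diff_distrib)

text \<open>In the second-order Taylor remainder half of the exponent \<open>r * u\<close> absorbs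
  \<open>exp z\<close>, the other half absorbs \<open>u\<^sup>2\<close>; the bound is uniform in
  \<open>t\<close>.\<close>

lemma exp_minus_le_quadratic:
  fixes t r u :: real
  assumes "0 < r" "0 \<le> u" "\<bar>t\<bar> \<le> r / 2"
  shows "exp (- (t * u)) \<le> 1 - t * u + t\<^sup>2 * (4 / r\<^sup>2 * exp (r * u))"
proof -
  obtain z where z: "\<bar>z\<bar> \<le> \<bar>- (t * u)\<bar>"
    "exp (- (t * u)) = (\<Sum>m<2. (- (t * u)) ^ m / fact m) + exp z / fact 2 * (- (t * u)) ^ 2"
    using Maclaurin_exp_le[of "- (t * u)" 2] by blast
  have "\<bar>t * u\<bar> \<le> r / 2 * u" unfolding abs_mult using mult_right_mono[OF assms(3,2)] assms(2) by simp
  then have "exp z \<le> exp (r / 2 * u)" using z(1) by simp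
  moreover have "u\<^sup>2 \<le> 8 / r\<^sup>2 * exp (r / 2 * u)"
  proof -
    have "1 + r / 2 * u + (r / 2 * u)\<^sup>2 / 2 \<le> exp (r / 2 * u)"
      by (rule exp_lower_Taylor_quadratic) (use assms in simp)
    moreover have "0 \<le> r / 2 * u" using assms by simp
    ultimately have "(r / 2 * u)\<^sup>2 / 2 \<le> exp (r / 2 * u)" by linarith
    then show ?thesis using assms(1) by (simp add: field_simps power2_eq_square)
  qed
  ultimately have "exp z * u\<^sup>2 \<le> exp (r / 2 * u) * (8 / r\<^sup>2 * exp (r / 2 * u))"
    by (intro mult_mono) auto
  also have "\<dots> = 8 / r\<^sup>2 * exp (r * u)"
    by (simp add: exp_add[symmetric] mult.left_commute[of "exp _"])
  finally have le: "t\<^sup>2 * (exp z * u\<^sup>2) \<le> t\<^sup>2 * (8 / r\<^sup>2 * exp (r * u))" by (rule mult_left_mono) simp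
  have "exp (- (t * u)) = 1 - t * u + t\<^sup>2 * (exp z * u\<^sup>2) / 2"
    unfolding z(2) by (simp add: eval_nat_numeral)
  also have "\<dots> \<le> 1 - t * u + t\<^sup>2 * (8 / r\<^sup>2 * exp (r * u)) / 2"
    using le by (intro add_left_mono divide_right_mono) auto
  finally show ?thesis by (simp add: mult_ac)
qed

text \<open>The first-order variation of the weights: \<open>y\<^sup>2\<^sup>t = exp (2 t) exp (- t \<kappa> y)\<close>. The constant
  \<open>2\<close> keeps \<open>\<kappa>\<close> away from \<open>0\<close>, so that it is log-Lipschitz along the branches.\<close>

definition \<kappa> :: "real \<Rightarrow> real" where
  "\<kappa> y = 2 - 2 * ln y"

lemma \<kappa>_ge: "y \<in> {0<..1} \<Longrightarrow> 2 \<le> \<kappa> y"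
  by (simp add: \<kappa>_def)

lemma exp_\<kappa>: "y \<in> {0<..1} \<Longrightarrow> exp (r * \<kappa> y) = exp (2 * r) * y powr - (2 * r)"
  by (simp add: \<kappa>_def powr_def exp_add[symmetric] algebra_simps)

text \<open>Along the branch \<kappa> equals \<open>2 + 2 * ln (a + x)\<close>: its slope is at most
  \<open>2\<close> and its value at least \<open>2\<close>.\<close>

lemma \<kappa>_branch_log_lip:
  assumes "a \<ge> (1::nat)"
  shows "log_lip 1 (\<lambda>x. \<kappa> (1 / (real a + x)))"
  unfolding log_lip_def
proof (intro conjI ballI)
  fix x :: real assume x: "x \<in> {0..1}"
  show "0 < \<kappa> (1 / (real a + x))" using \<kappa>_ge[OF inverse_add_unit(1)[OF x assms]] by simp
  fix y :: real assume y: "y \<in> {0..1}"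
  have p: "1 \<le> real a + x" "1 \<le> real a + y" using x y assms by auto
  have "ln (real a + x) - ln (real a + y) \<le> (x - y) / (real a + y)"
    using ln_diff_le[of "real a + x" "real a + y"] p by simp
  also have "\<dots> \<le> \<bar>x - y\<bar> / (real a + y)" using p by (intro divide_right_mono) auto
  also have "\<dots> \<le> \<bar>x - y\<bar>" using p mult_left_mono[of 1 "real a + y" "\<bar>x - y\<bar>"] by (simp add: pos_divide_le_eq)
  finally have "2 + 2 * ln (real a + x) \<le> 2 + 2 * ln (real a + y) + 2 * \<bar>x - y\<bar>" by simp
  also have "\<dots> \<le> (1 + \<bar>x - y\<bar>) * (2 + 2 * ln (real a + y))"
    using p(2) mult_nonneg_nonneg[of "\<bar>x - y\<bar>" "ln (real a + y)"] by (simp add: algebra_simps)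
  also have "\<dots> \<le> exp (1 * \<bar>x - y\<bar>) * (2 + 2 * ln (real a + y))"
    using p(2) by (intro mult_right_mono) auto
  finally show "\<kappa> (1 / (real a + x)) \<le> exp (1 * \<bar>x - y\<bar>) * \<kappa> (1 / (real a + y))"
    using p by (simp add: \<kappa>_def ln_div)
qed

text \<open>With \<open>f = h - t * k\<close>, the first-order term of the operator at
  \<open>s + t\<close>, after removing \<open>exp (2 * t)\<close>, is \<open>- t\<close> times
  \<open>b\<close> plus the image of \<open>k\<close>. The corrector equation turns this into
  \<open>- t * c * h\<close>, up to the part belonging to \<open>l * f\<close>. So \<open>f\<close>
  is a supersolution with factor \<open>exp (2 * t) * (l - t * c + o(t))\<close>, and the slope is
  \<open>2 - c / l\<close>.\<close>

lemma pressure_upper_tangent: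
  assumes "s > 1/2"
  obtains d where "\<And>e. 0 < e \<Longrightarrow> \<exists>\<delta>>0. \<forall>t. \<bar>t\<bar> < \<delta> \<longrightarrow>
    1/2 < s + t \<and> pressure (s + t) \<le> pressure s + t * d + e * \<bar>t\<bar>"
proof -
  obtain h where h: "log_lip (2 * s) h" "\<And>x. x \<in> {0..1} \<Longrightarrow> transfer s h x = exp (pressure s) * h x"
    using eigenfunction_exists[OF assms] by metis
  have M: "0 \<le> 2 * s" using assms by simp
  obtain m C where mC: "0 < m" "m \<le> C" "\<And>x. x \<in> {0..1} \<Longrightarrow> m \<le> h x" "\<And>x. x \<in> {0..1} \<Longrightarrow> h x \<le> C"
    using log_lip_bounded[OF h(1) M] by metis
  \<comment> \<open>Half the distance to \<open>1/2\<close>: the series still converges at exponent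
    \<open>s - r\<close>, which leaves room for the factor
    \<open>exp (r * \<kappa> y)\<close>.\<close>
  define r where "r = (s - 1/2) / 2"
  have r: "0 < r" "1/2 < s - r" unfolding r_def using assms by (auto simp: field_simps)
  \<comment> \<open>Up to a constant this is \<open>y powr - (2 * r)\<close>; it dominates both
    \<kappa> and the Taylor remainder.\<close>
  define \<rho> where "\<rho> y = exp (r * \<kappa> y)" for y
  have \<rho>: "\<rho> y = exp (2 * r) * (y powr - (2 * r) * 1)" if "y \<in> {0<..1}" for y
    unfolding \<rho>_def using exp_\<kappa>[OF that] by simp
  have \<rho>_adm: "admissible s \<rho>"
    by (rule admissible_comparison[OF admissible_cmult[OF admissible_shift[OF admissible_const[OF r(2)]], of "exp (2 * r)"]])
      (use \<rho> in auto)
  define R where "R = exp (2 * r) * transfer (s - r) (\<lambda>_. 1) 0"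
  have \<rho>_T: "transfer s \<rho> x \<le> R" if x: "x \<in> {0..1}" for x
  proof -
    have "transfer s \<rho> x = transfer s (\<lambda>y. exp (2 * r) * (y powr - (2 * r) * 1)) x"
      by (rule transfer_cong[OF \<rho> x])
    also have "\<dots> = exp (2 * r) * transfer (s - r) (\<lambda>_. 1) x"
      unfolding transfer_cmult using transfer_shift[OF x, of s "-r" "\<lambda>_. 1"] by simp
    also have "\<dots> \<le> R" unfolding R_def using transfer_one_bounds(2)[OF r(2) x] by simp
    finally show ?thesis .
  qed
  have R: "0 \<le> R" unfolding R_def using transfer_one_bounds(1)[OF r(2), of 0] by simp
  have \<kappa>_le: "\<kappa> y \<le> \<rho> y / r" if "y \<in> {0<..1}" for y
  proof -
    have "r * \<kappa> y \<le> exp (r * \<kappa> y)" using exp_ge_add_one_self[of "r * \<kappa> y"] by linarith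
    then show ?thesis unfolding \<rho>_def using r(1) by (simp add: pos_le_divide_eq mult.commute)
  qed
  have \<kappa>f_adm: "admissible s (\<lambda>y. \<kappa> y * f y)"
    if f: "\<And>y. y \<in> {0..1} \<Longrightarrow> 0 \<le> f y" "\<And>y. y \<in> {0..1} \<Longrightarrow> f y \<le> K" for f K
  proof (rule admissible_comparison[OF admissible_cmult[OF \<rho>_adm, of "K / r"]])
    fix y :: real assume y: "y \<in> {0<..1}"
    have "\<kappa> y * f y \<le> \<rho> y / r * K"
      using \<kappa>_le[OF y] f[of y] y r(1) by (intro mult_mono) (auto simp: \<rho>_def)
    then show "\<bar>\<kappa> y * f y\<bar> \<le> K / r * \<rho> y"
      using \<kappa>_ge[OF y] f(1)[of y] y by (simp add: abs_mult mult_ac)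
  qed
  have h0: "0 \<le> h y" if "y \<in> {0..1}" for y using log_lip_pos[OF h(1) that] by simp
  define b where "b = transfer s (\<lambda>y. \<kappa> y * h y)"
  have \<kappa>h_adm: "admissible s (\<lambda>y. \<kappa> y * h y)" using \<kappa>f_adm[of h C] h0 mC(4) by blast
  \<comment> \<open>The weight and \<open>h\<close> contribute \<open>2 * s\<close> each, \<kappa>
    contributes \<open>1\<close>.\<close>
  have b_lip: "log_lip ((2 * s + 2 * s) + 1) b"
  proof (rule has_sum_log_lip)
    show "((\<lambda>a::nat. (1 / (real a + x)) powr (2 * s) * (\<kappa> (1 / (real a + x)) * h (1 / (real a + x))))
        has_sum b x) {1..}" if "x \<in> {0..1}" for x
      unfolding b_def by (rule transfer_has_sum[OF \<kappa>h_adm that])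
    show "log_lip ((2 * s + 2 * s) + 1)
        (\<lambda>x. (1 / (real a + x)) powr (2 * s) * (\<kappa> (1 / (real a + x)) * h (1 / (real a + x))))"
      if "a \<in> {1..}" for a :: nat
      using log_lip_mult[OF weighted_branch_log_lip[OF assms M h(1), of "[a]"] \<kappa>_branch_log_lip[of a]] that
      by (simp add: weight_Cons mult_ac)
  qed auto
  define l where "l = exp (pressure s)"
  have l: "0 < l" unfolding l_def by simp
  have Mb: "0 \<le> (2 * s + 2 * s) + 1" using M by simp
  obtain c where c: "\<And>e. 0 < e \<Longrightarrow> \<exists>k K. (\<forall>x\<in>{0..1}. 0 \<le> k x \<and> k x \<le> K) \<and>
    (\<forall>x\<in>{0..1}. \<bar>transfer s k x + b x - l * k x - c * h x\<bar> \<le> e)"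
    unfolding l_def using corrector_exists[OF assms Mb b_lip M h] by metis
  show ?thesis
  proof (rule that[of "2 - c / l"])
    fix e :: real assume e: "0 < e"
    \<comment> \<open>After multiplication by \<open>2 / m\<close> and division by \<open>l\<close>
      this error becomes \<open>e / 2\<close>.\<close>
    define e' where "e' = e * (m * l) / 4"
    have "0 < e'" unfolding e'_def using e mC l by simp
    from c[OF this] obtain k K where k: "\<And>x. x \<in> {0..1} \<Longrightarrow> 0 \<le> k x" "\<And>x. x \<in> {0..1} \<Longrightarrow> k x \<le> K"
      and k_eq: "\<And>x. x \<in> {0..1} \<Longrightarrow> \<bar>transfer s k x + b x - l * k x - c * h x\<bar> \<le> e'"
      by metis
    have K: "0 \<le> K" using k[of 0] by simp
    \<comment> \<open>\<open>G\<close> collects the terms quadratic in \<open>t\<close>: the product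
      of the two first-order terms, and the Taylor remainder times \<open>f \<le> C + m\<close>. In
      \<open>H\<close> the factor \<open>2 / m\<close> turns additive errors into multiples of
      \<open>f\<close>, as \<open>f \<ge> m / 2\<close>.\<close>
    define G where "G = K / r + 4 / r\<^sup>2 * (C + m)"
    define H where "H = (G * R + \<bar>c\<bar> * K) * (2 / m)"
    have G: "0 \<le> G" unfolding G_def using K r mC by simp
    have H: "0 \<le> H" unfolding H_def using G R K mC by simp
    \<comment> \<open>The four bounds secure, in order: the range of the Taylor estimate and
      \<open>s + t > 1/2\<close>; \<open>f \<ge> m / 2\<close>; \<open>\<mu> > 0\<close>; a
      quadratic error of at most \<open>e / 2 * \<bar>t\<bar>\<close>.\<close>
    define \<delta> where "\<delta> = min (min (r / 2) (m / (2 * (K + 1)))) (min (l / (2 * (\<bar>c\<bar> + 1))) (l * e / (2 * (H + 1))))"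
    have \<delta>: "0 < \<delta>" unfolding \<delta>_def using r mC K l e H by simp
    have "1/2 < s + t \<and> pressure (s + t) \<le> pressure s + t * (2 - c / l) + e * \<bar>t\<bar>" if t: "\<bar>t\<bar> < \<delta>" for t
    proof
      have t1: "\<bar>t\<bar> \<le> r / 2" and t2: "\<bar>t\<bar> * (K + 1) \<le> m / 2" and t3: "\<bar>t\<bar> * (\<bar>c\<bar> + 1) \<le> l / 2"
        and t4: "\<bar>t\<bar> * (H + 1) \<le> l * e / 2"
        using t K H unfolding \<delta>_def by (auto simp: field_simps)
      show st: "1/2 < s + t" using t1 r by (auto simp: r_def field_simps abs_le_iff)
      define f where "f y = h y - t * k y" for y
      have tk: "\<bar>t * k y\<bar> \<le> m / 2" if "y \<in> {0..1}" for y
      proof -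
        have "\<bar>t * k y\<bar> \<le> \<bar>t\<bar> * (K + 1)" unfolding abs_mult
          using k[OF that] by (intro mult_left_mono) auto
        then show ?thesis using t2 by linarith
      qed
      have f: "m / 2 \<le> f y" "f y \<le> C + m" if "y \<in> {0..1}" for y
        using tk[OF that] mC(3,4)[OF that] mC(1) unfolding f_def by (auto simp: abs_le_iff)
      have h_adm: "admissible s h" by (rule log_lip_admissible[OF assms M h(1)])
      have k_adm: "admissible s k"
        by (rule admissible_bounded[OF assms, of k K]) (use k in auto)
      have f_adm: "admissible s f"
        unfolding f_def using admissible_add[OF h_adm admissible_cmult[OF k_adm, of "-t"]] by simp
      define \<mu> where "\<mu> = l - t * c + \<bar>t\<bar> * e' * (2 / m) + t\<^sup>2 * H"
      have \<mu>: "0 < \<mu>"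
      proof -
        have "t * c \<le> \<bar>t\<bar> * (\<bar>c\<bar> + 1)"
          using abs_ge_self[of "t * c"] by (simp add: abs_mult algebra_simps)
        moreover have "0 \<le> \<bar>t\<bar> * e' * (2 / m)" "0 \<le> t\<^sup>2 * H" using \<open>0 < e'\<close> mC H by simp_all
        ultimately show ?thesis unfolding \<mu>_def using t3 l by linarith
      qed
      have super: "transfer (s + t) f x \<le> (exp (2 * t) * \<mu>) * f x" if x: "x \<in> {0..1}" for x
      proof -
        let ?g = "\<lambda>y. (h y - t * k y) - t * (\<kappa> y * h y) + t\<^sup>2 * G * \<rho> y"
        have g_adm: "admissible s (\<lambda>y. (h y - t * k y) - t * (\<kappa> y * h y))"
          using admissible_add[OF admissible_add[OF h_adm admissible_cmult[OF k_adm, of "-t"]] admissible_cmult[OF \<kappa>h_adm, of "-t"]]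
          by simp
        have bound: "exp (- (t * \<kappa> y)) * f y \<le> ?g y" if y: "y \<in> {0<..1}" for y
        proof -
          have y': "y \<in> {0..1}" using y by auto
          have "exp (- (t * \<kappa> y)) * f y \<le> (1 - t * \<kappa> y + t\<^sup>2 * (4 / r\<^sup>2 * \<rho> y)) * f y"
            unfolding \<rho>_def using exp_minus_le_quadratic[OF r(1) _ t1, of "\<kappa> y"] \<kappa>_ge[OF y] f(1)[OF y'] mC(1)
            by (intro mult_right_mono) auto
          also have "\<dots> = (h y - t * k y) - t * (\<kappa> y * h y) + t\<^sup>2 * (\<kappa> y * k y + 4 / r\<^sup>2 * \<rho> y * f y)"
            unfolding f_def by (simp add: algebra_simps power2_eq_square)
          also have "\<dots> \<le> (h y - t * k y) - t * (\<kappa> y * h y) + t\<^sup>2 * (\<rho> y / r * K + 4 / r\<^sup>2 * \<rho> y * (C + m))"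
          proof (intro add_left_mono mult_left_mono add_mono)
            show "\<kappa> y * k y \<le> \<rho> y / r * K"
              using \<kappa>_le[OF y] k[OF y'] r(1) by (intro mult_mono) (auto simp: \<rho>_def)
          qed (use f(2)[OF y'] in \<open>auto simp: \<rho>_def\<close>)
          also have "\<dots> = ?g y" unfolding G_def by (simp add: algebra_simps)
          finally show ?thesis .
        qed
        have ef_adm: "admissible s (\<lambda>y. exp (- (t * \<kappa> y)) * f y)"
        proof (rule admissible_comparison[OF admissible_cmult[OF \<rho>_adm, of "C + m"]])
          fix y :: real assume y: "y \<in> {0<..1}"
          have "- (t * \<kappa> y) \<le> r * \<kappa> y"
            using mult_right_mono[of "-t" r "\<kappa> y"] t1 r(1) \<kappa>_ge[OF y] by auto
          then have "exp (- (t * \<kappa> y)) \<le> \<rho> y" unfolding \<rho>_def by simp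
          then have "exp (- (t * \<kappa> y)) * f y \<le> \<rho> y * (C + m)"
            using f[of y] y mC(1) by (intro mult_mono) (auto simp: \<rho>_def)
          then show "\<bar>exp (- (t * \<kappa> y)) * f y\<bar> \<le> (C + m) * \<rho> y"
            using f(1)[of y] y mC(1) by (simp add: abs_mult mult.commute)
        qed
        have "transfer (s + t) f x = transfer s (\<lambda>y. y powr (2 * t) * f y) x" by (rule transfer_shift[OF x])
        also have "\<dots> = transfer s (\<lambda>y. exp (2 * t) * (exp (- (t * \<kappa> y)) * f y)) x"
          by (rule transfer_cong[OF _ x]) (use exp_\<kappa>[of _ "-t"] in \<open>simp add: exp_minus field_simps\<close>)
        also have "\<dots> = exp (2 * t) * transfer s (\<lambda>y. exp (- (t * \<kappa> y)) * f y) x" by (rule transfer_cmult)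
        finally have 1: "transfer (s + t) f x = exp (2 * t) * transfer s (\<lambda>y. exp (- (t * \<kappa> y)) * f y) x" .
        have "transfer s (\<lambda>y. exp (- (t * \<kappa> y)) * f y) x \<le> transfer s ?g x"
          by (rule transfer_mono[OF ef_adm admissible_add[OF g_adm admissible_cmult[OF \<rho>_adm]] x bound])
        also have "\<dots> = l * h x - t * transfer s k x - t * b x + t\<^sup>2 * G * transfer s \<rho> x"
          using transfer_add[OF g_adm admissible_cmult[OF \<rho>_adm, of "t\<^sup>2 * G"] x]
            transfer_diff[OF _ admissible_cmult[OF \<kappa>h_adm, of t] x, of f]
            transfer_diff[OF h_adm admissible_cmult[OF k_adm, of t] x] h(2)[OF x] f_adm
          by (simp add: transfer_cmult b_def l_def f_def[abs_def])
        also have "\<dots> \<le> l * h x - t * transfer s k x - t * b x + t\<^sup>2 * G * R"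
          using \<rho>_T[OF x] G by (intro add_left_mono mult_left_mono) auto
        \<comment> \<open>Substituting \<open>h = f + t * k\<close> isolates the residual of the
          corrector equation, which is at most \<open>e'\<close>; the rest is of order
          \<open>t\<^sup>2\<close>.\<close>
        also have "\<dots> = (l - t * c) * f x - t * (transfer s k x + b x - l * k x - c * h x)
            + t\<^sup>2 * (G * R - c * k x)"
          unfolding f_def by (simp add: algebra_simps power2_eq_square)
        also have "\<dots> \<le> (l - t * c) * f x + \<bar>t\<bar> * e' + t\<^sup>2 * (G * R + \<bar>c\<bar> * K)"
        proof -
          have "- (t * (transfer s k x + b x - l * k x - c * h x)) \<le> \<bar>t\<bar> * e'"
            using mult_left_mono[OF k_eq[OF x], of "\<bar>t\<bar>"] by (simp add: abs_mult[symmetric] abs_le_iff)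
          moreover have "- (c * k x) \<le> \<bar>c\<bar> * K"
          proof -
            have "- (c * k x) \<le> \<bar>c\<bar> * k x" using mult_right_mono[of "-c" "\<bar>c\<bar>" "k x"] k(1)[OF x] by simp
            also have "\<dots> \<le> \<bar>c\<bar> * K" using k(2)[OF x] by (intro mult_left_mono) auto
            finally show ?thesis .
          qed
          then have "t\<^sup>2 * (G * R - c * k x) \<le> t\<^sup>2 * (G * R + \<bar>c\<bar> * K)" by (intro mult_left_mono) auto
          ultimately show ?thesis by linarith
        qed
        also have "\<dots> \<le> \<mu> * f x"
        proof -
          have "1 \<le> 2 / m * f x" using f(1)[OF x] mC(1) by (simp add: field_simps)
          moreover have "0 \<le> \<bar>t\<bar> * e' + t\<^sup>2 * (G * R + \<bar>c\<bar> * K)" using \<open>0 < e'\<close> G R K by simp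
          ultimately have "(\<bar>t\<bar> * e' + t\<^sup>2 * (G * R + \<bar>c\<bar> * K)) * 1
              \<le> (\<bar>t\<bar> * e' + t\<^sup>2 * (G * R + \<bar>c\<bar> * K)) * (2 / m * f x)" by (rule mult_left_mono)
          then show ?thesis unfolding \<mu>_def H_def by (simp add: algebra_simps)
        qed
        finally show ?thesis unfolding 1 by (simp add: mult.assoc)
      qed
      have "pressure (s + t) \<le> ln (exp (2 * t) * \<mu>)"
        by (rule pressure_le_if_supersolution[OF st _ _ f super]) (use mC \<mu> in auto)
      also have "\<dots> = 2 * t + ln \<mu>" using \<mu> by (simp add: ln_mult_pos)
      also have "\<dots> \<le> 2 * t + (ln l + (\<mu> - l) / l)"
        using ln_diff_le[OF \<mu> l] by simp
      also have "\<dots> = pressure s + t * (2 - c / l) + (\<bar>t\<bar> * (e / 2) + \<bar>t\<bar> * (\<bar>t\<bar> * H) / l)"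
        unfolding \<mu>_def e'_def using l mC by (simp add: l_def[symmetric] field_simps power2_eq_square) (simp add: l_def)
      also have "\<dots> \<le> pressure s + t * (2 - c / l) + (\<bar>t\<bar> * (e / 2) + \<bar>t\<bar> * (e / 2))"
      proof -
        have "\<bar>t\<bar> * H \<le> l * (e / 2)" using t4 by (simp add: algebra_simps)
        then have "\<bar>t\<bar> * (\<bar>t\<bar> * H) / l \<le> \<bar>t\<bar> * (e / 2)"
          using l mult_left_mono[of "\<bar>t\<bar> * H" "l * (e / 2)" "\<bar>t\<bar>"] by (simp add: field_simps)
        then show ?thesis by linarith
      qed
      finally show "pressure (s + t) \<le> pressure s + t * (2 - c / l) + e * \<bar>t\<bar>"
        by (simp add: field_simps)
    qed
    then show "\<exists>\<delta>>0. \<forall>t. \<bar>t\<bar> < \<delta> \<longrightarrow>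
        1/2 < s + t \<and> pressure (s + t) \<le> pressure s + t * (2 - c / l) + e * \<bar>t\<bar>"
      using \<delta> by blast
  qed
qed

text \<open>The upper tangent bound at \<open>s - t\<close> becomes a lower bound at
  \<open>s + t\<close> through midpoint convexity, so the difference quotient is squeezed.\<close>

theorem pressure_differentiable:
  assumes "s > 1/2"
  obtains d where "(pressure has_real_derivative d) (at s)"
proof -
  obtain d where d: "\<And>e. 0 < e \<Longrightarrow> \<exists>\<delta>>0. \<forall>t. \<bar>t\<bar> < \<delta> \<longrightarrow>
    1/2 < s + t \<and> pressure (s + t) \<le> pressure s + t * d + e * \<bar>t\<bar>"
    using pressure_upper_tangent[OF assms] by metis
  have "(pressure has_real_derivative d) (at s)"
    unfolding DERIV_def LIM_def dist_real_def
  proof (intro allI impI)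
    fix e :: real assume e: "0 < e"
    then obtain \<delta> where \<delta>: "0 < \<delta>" "\<And>t. \<bar>t\<bar> < \<delta> \<Longrightarrow> 1/2 < s + t"
      "\<And>t. \<bar>t\<bar> < \<delta> \<Longrightarrow> pressure (s + t) \<le> pressure s + t * d + e / 2 * \<bar>t\<bar>"
      using d[of "e / 2"] by auto
    have "\<bar>(pressure (s + t) - pressure s) / t - d\<bar> < e" if t: "t \<noteq> 0" "\<bar>t\<bar> < \<delta>" for t
    proof -
      have "2 * pressure s < pressure (s + t) + pressure (s - t)"
      proof (cases "0 < t")
        case True
        then show ?thesis
          using pressure_midpoint_strict[of "s - t" "s + t"] \<delta>(2)[of "-t"] t by simp
      next
        case False
        then show ?thesis
          using pressure_midpoint_strict[of "s + t" "s - t"] \<delta>(2)[of t] t by simp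
      qed
      moreover have "pressure (s - t) \<le> pressure s - t * d + e / 2 * \<bar>t\<bar>" using \<delta>(3)[of "-t"] t by simp
      ultimately have "\<bar>pressure (s + t) - pressure s - t * d\<bar> \<le> e / 2 * \<bar>t\<bar>"
        using \<delta>(3)[OF t(2)] by linarith
      moreover have "(pressure (s + t) - pressure s) / t - d = (pressure (s + t) - pressure s - t * d) / t"
        using t by (simp add: field_simps)
      ultimately have "\<bar>(pressure (s + t) - pressure s) / t - d\<bar> \<le> e / 2"
        using t by (simp add: abs_divide pos_divide_le_eq)
      then show ?thesis using e by linarith
    qed
    then show "\<exists>\<delta>>0. \<forall>t. t \<noteq> 0 \<and> \<bar>t - 0\<bar> < \<delta> \<longrightarrow> \<bar>(pressure (s + t) - pressure s) / t - d\<bar> < e"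
      using \<delta>(1) by auto
  qed
  then show ?thesis by (rule that)
qed

section \<open>The minimum of \<open>P s + s \<beta>\<close>\<close>

text \<open>The density \<open>1 / (1 + x)\<close> of the Gauss measure is fixed by the transfer operator for \<open>s = 1\<close>.\<close>

lemma pressure_1_le: "pressure 1 \<le> 0"
proof -
  define f :: "real \<Rightarrow> real" where "f x = 1 / (1 + x)" for x
  have T: "transfer 1 f x = f x" if x: "x \<in> {0..1}" for x
  proof (rule transfer_eqI)
    let ?u = "\<lambda>n. 1 / (real n + 1 + x)"
    let ?g = "\<lambda>a. (1 / (real a + x)) powr (2 * 1) * f (1 / (real a + x))"
    \<comment> \<open>Partial fractions make the series telescope; the shift to \<open>Suc n\<close>
      matches letters starting at \<open>1\<close>.\<close>
    have g: "?g (Suc n) = ?u n - ?u (Suc n)" for n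
    proof -
      have p: "0 < real n + 1 + x" "0 < real n + 2 + x" using x by auto
      have "?g (Suc n) = (1 / (real n + 1 + x))\<^sup>2 * (1 / (1 + 1 / (real n + 1 + x)))"
        unfolding f_def using p by (simp add: add.commute)
      also have "1 / (1 + 1 / (real n + 1 + x)) = (real n + 1 + x) / (real n + 2 + x)"
        using p by (simp add: divide_simps)
      also have "(1 / (real n + 1 + x))\<^sup>2 * ((real n + 1 + x) / (real n + 2 + x)) = 1 / ((real n + 1 + x) * (real n + 2 + x))"
        using p by (simp add: power2_eq_square)
      also have "\<dots> = 1 / (real n + 1 + x) - 1 / (real n + 2 + x)"
        using p by (simp add: divide_simps)
      finally show ?thesis by (simp add: add_ac)
    qed
    have "?u \<longlonglongrightarrow> 0"
    proof (rule Lim_null_comparison)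
      show "\<forall>\<^sub>F n in sequentially. norm (?u n) \<le> 1 / real (Suc n)"
        using x by (intro always_eventually) (auto intro!: frac_le)
      show "(\<lambda>a. 1 / real (Suc a)) \<longlonglongrightarrow> 0" using LIMSEQ_inverse_real_of_nat by (simp add: inverse_eq_divide)
    qed
    then have "(\<lambda>n. ?u n - ?u (Suc n)) sums (?u 0 - 0)" by (rule telescope_sums')
    then have "(\<lambda>n. ?g (Suc n)) sums f x" unfolding g by (simp add: f_def)
    then have "((\<lambda>n. ?g (Suc n)) has_sum f x) UNIV"
      by (rule sums_nonneg_imp_has_sum) (use x in \<open>simp add: f_def\<close>)
    moreover have "bij_betw Suc UNIV {1..}"
      by (rule bij_betwI[where g = "\<lambda>n. n - 1"]) auto
    ultimately show "(?g has_sum f x) {1..}" using has_sum_reindex_bij_betw[of Suc UNIV "{1..}" ?g] by blast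
  qed
  have "pressure 1 \<le> ln 1"
    by (rule pressure_le_if_supersolution[of 1 "1/2" 1 f 1]) (use T in \<open>auto simp: f_def field_simps\<close>)
  then show ?thesis by simp
qed

section \<open>Existence and uniqueness of the critical point\<close>

lemma \<gamma>\<^sub>0_pos: "0 < \<gamma>\<^sub>0"
proof -
  have "1 < (1 + r) / 2" if "1 < r" for r :: real using that by simp
  from this[of "sqrt 5"] have "1 < (1 + sqrt 5) / (2::real)" by (simp add: real_less_rsqrt)
  then show ?thesis unfolding \<gamma>\<^sub>0_def by (simp add: ln_gt_zero)
qed

text \<open>At \<open>1/2\<close> the lower bounds of \<open>pressure_ge_partial_sum\<close> are
  partial sums of the harmonic series. One of them exceeding \<open>exp K\<close> still does so for
  nearby \<open>s\<close>, by continuity of a finite sum.\<close>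

lemma pressure_unbounded_near_half:
  obtains \<sigma> where "1/2 < \<sigma>" "\<And>s. 1/2 < s \<Longrightarrow> s < \<sigma> \<Longrightarrow> K \<le> pressure s"
proof -
  define S where "S N s = (\<Sum>a=1..N. (1 / (real a + 1)) powr (2 * s))" for N and s :: real
  have "\<exists>N\<ge>1. exp K < S N (1/2)"
  proof (rule ccontr)
    assume "\<not> ?thesis"
    then have le: "S N (1/2) \<le> exp K" if "N \<ge> 1" for N using that by (auto simp: not_less)
    have "summable (\<lambda>a. (1 / (real (Suc a) + 1)) powr (2 * (1/2)))"
    proof (rule summableI_nonneg_bounded)
      fix n
      have "(\<Sum>a<n. (1 / (real (Suc a) + 1)) powr (2 * (1/2))) = S n (1/2)"
        unfolding S_def by (rule sum.reindex_bij_witness[where i = "\<lambda>a. a - 1" and j = Suc]) auto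
      then show "(\<Sum>a<n. (1 / (real (Suc a) + 1)) powr (2 * (1/2))) \<le> exp K"
        using le[of n] by (cases "n = 0") auto
    qed simp
    \<comment> \<open>The shift is by two: letters start at \<open>1\<close>, and evaluation at
      \<open>x = 1\<close> adds another \<open>1\<close>.\<close>
    moreover have "(1 / (real (Suc a) + 1)) powr (2 * (1/2)) = real (a + 2) powr (-1)" for a
      by (simp add: powr_minus_divide add_ac)
    ultimately have "summable (\<lambda>a. real (a + 2) powr (-1))" by simp
    then have "summable (\<lambda>a. real a powr (-1))" using summable_iff_shift[of "\<lambda>a. real a powr (-1)" 2] by simp
    then show False unfolding summable_real_powr_iff by simp
  qed
  then obtain N where N: "N \<ge> 1" "exp K < S N (1/2)" by blast
  have "((\<lambda>s. S N s) \<longlongrightarrow> S N (1/2)) (at (1/2))"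
    unfolding S_def by (intro tendsto_intros) auto
  then have "\<forall>\<^sub>F s in at (1/2). exp K < S N s" using N(2) by (rule order_tendstoD(1))
  then obtain d where d: "0 < d" "\<And>s. s \<noteq> 1/2 \<Longrightarrow> \<bar>s - 1/2\<bar> < d \<Longrightarrow> exp K < S N s"
    unfolding eventually_at dist_real_def by auto
  show ?thesis
  proof (rule that[of "1/2 + d"])
    fix s :: real assume s: "1/2 < s" "s < 1/2 + d"
    have "exp K < S N s" using d(2)[of s] s by simp
    then have "ln (exp K) \<le> ln (S N s)" by (subst ln_le_cancel_iff) (auto intro: less_trans[OF exp_gt_zero])
    then show "K \<le> pressure s" using pressure_ge_partial_sum[OF s(1) N(1)] unfolding S_def by simp
  qed (use d in simp)
qed

text \<open>Outside a compact interval \<open>G\<close> is at least \<open>G 1\<close>: near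
  \<open>1/2\<close> by the blow-up, and for large \<open>s\<close> because
  \<open>pressure_ge_golden\<close> leaves growth at rate
  \<open>\<beta> - \<gamma>\<^sub>0 > 0\<close>.\<close>

lemma pressure_tilted_minimum:
  assumes "\<beta> > \<gamma>\<^sub>0"
  obtains s0 where "1/2 < s0" "\<And>s. 1/2 < s \<Longrightarrow> pressure s0 + s0 * \<beta> \<le> pressure s + s * \<beta>"
proof -
  have \<beta>: "0 < \<beta>" using assms \<gamma>\<^sub>0_pos by simp
  define G where "G s = pressure s + s * \<beta>" for s
  obtain \<sigma> where \<sigma>: "1/2 < \<sigma>" "\<And>s. 1/2 < s \<Longrightarrow> s < \<sigma> \<Longrightarrow> G 1 \<le> pressure s"
    using pressure_unbounded_near_half by metis
  have low: "G 1 \<le> G s" if "1/2 < s" "s < \<sigma>" for s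
    using \<sigma>(2)[OF that] mult_pos_pos[of s \<beta>] that \<beta> unfolding G_def by linarith
  define T where "T = G 1 / (\<beta> - \<gamma>\<^sub>0)"
  have high: "G 1 \<le> G s" if "1/2 < s" "T < s" for s
  proof -
    have "G 1 \<le> s * (\<beta> - \<gamma>\<^sub>0)" using that(2) assms unfolding T_def by (simp add: pos_divide_less_eq)
    then show ?thesis using pressure_ge_golden[OF that(1)] unfolding G_def by (simp add: algebra_simps)
  qed
  \<comment> \<open>The interval is made to contain \<open>1\<close>, so its minimum also beats the
    value \<open>G 1\<close> used outside.\<close>
  define I where "I = {min \<sigma> 1..max T 1}"
  have sub: "1/2 < s" if "s \<in> I" for s using that \<sigma>(1) unfolding I_def by auto
  have "isCont pressure s" if "s \<in> I" for s
    using pressure_differentiable[OF sub[OF that]] DERIV_isCont by metis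
  then have "continuous_on I G" unfolding G_def
    by (intro continuous_intros continuous_at_imp_continuous_on) auto
  moreover have I: "compact I" "1 \<in> I" unfolding I_def by auto
  ultimately obtain s0 where s0: "s0 \<in> I" "\<And>s. s \<in> I \<Longrightarrow> G s0 \<le> G s"
    using continuous_attains_inf[of I G] by auto
  have "G s0 \<le> G s" if "1/2 < s" for s
  proof (cases "s \<in> I")
    case False
    then have "s < \<sigma> \<or> T < s" unfolding I_def by auto
    then show ?thesis using low high that s0(2)[OF I(2)] by fastforce
  qed (use s0 in auto)
  then show ?thesis using that[OF sub[OF s0(1)]] unfolding G_def by blast
qed

text \<open>A critical point \<open>s1\<close> other than \<open>s0\<close> would have
  \<open>G s0 < G s1\<close>. Halving the segment from \<open>s1\<close> towards \<open>s0\<close>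
  keeps the chord slopes at least as steep as the full chord, which contradicts derivative
  \<open>0\<close> at \<open>s1\<close>.\<close>

lemma pressure_tilted_minimum_unique:
  assumes s0: "1/2 < s0" "\<And>s. 1/2 < s \<Longrightarrow> pressure s0 + s0 * \<beta> \<le> pressure s + s * \<beta>"
    and s1: "1/2 < s1" "(pressure has_real_derivative - \<beta>) (at s1)"
  shows "s1 = s0"
proof (rule ccontr)
  assume ne: "s1 \<noteq> s0"
  define G where "G s = pressure s + s * \<beta>" for s
  have mid: "G ((a + b) / 2) < (G a + G b) / 2" if "1/2 < a" "1/2 < b" "a \<noteq> b" for a b
    using that pressure_midpoint_strict[of a b] pressure_midpoint_strict[of b a]
    unfolding G_def by (cases "a < b") (auto simp: add.commute field_simps)
  have min: "G s0 \<le> G s" if "1/2 < s" for s using s0(2)[OF that] unfolding G_def .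
  have "G s0 < (G s1 + G s0) / 2"
    using mid[OF s1(1) s0(1) ne] min[of "(s1 + s0) / 2"] s0(1) s1(1) by simp
  then have lt: "G s0 < G s1" by simp
  define d where "d = s0 - s1"
  have halving: "G (s1 + d / 2 ^ k) - G s1 \<le> (G s0 - G s1) / 2 ^ k" for k
  proof (induction k)
    case 0
    then show ?case by (simp add: d_def)
  next
    case (Suc k)
    let ?b = "s1 + d / 2 ^ k"
    \<comment> \<open>As a convex combination of \<open>s1\<close> and \<open>s0\<close> the point
      stays beyond \<open>1/2\<close>, where midpoint convexity is available.\<close>
    have "?b = (1 - 1 / 2 ^ k) * s1 + 1 / 2 ^ k * s0" by (simp add: d_def field_simps)
    also have "\<dots> > (1 - 1 / 2 ^ k) * (1/2) + 1 / 2 ^ k * (1/2)"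
      using s0(1) s1(1) by (intro add_le_less_mono mult_left_mono mult_strict_left_mono) auto
    finally have b: "1/2 < ?b" by (simp add: field_simps)
    have "s1 \<noteq> ?b" using ne by (simp add: d_def)
    from mid[OF s1(1) b this] have "G (s1 + d / 2 ^ Suc k) < (G s1 + G ?b) / 2" by (simp add: field_simps)
    then have "G (s1 + d / 2 ^ Suc k) - G s1 \<le> (G ?b - G s1) / 2" by simp
    also have "\<dots> \<le> (G s0 - G s1) / 2 ^ k / 2" using Suc by (rule divide_right_mono) simp
    finally show ?case by simp
  qed
  have "(G has_real_derivative - \<beta> + \<beta>) (at s1)"
    unfolding G_def by (rule derivative_eq_intros s1(2) refl)+ simp
  then have "((\<lambda>t. (G (s1 + t) - G s1) / t) \<longlongrightarrow> 0) (at 0)" by (simp add: DERIV_def)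
  moreover have "filterlim (\<lambda>k. d / 2 ^ k) (at 0) sequentially"
  proof (rule filterlim_atI)
    show "(\<lambda>k. d / 2 ^ k) \<longlonglongrightarrow> 0"
      using tendsto_mult_left[OF LIMSEQ_power_zero[of "1/2 :: real"], of d] by (simp add: power_one_over)
    show "\<forall>\<^sub>F k in sequentially. d / 2 ^ k \<noteq> 0" using ne by (simp add: d_def)
  qed
  ultimately have "(\<lambda>k. (G (s1 + d / 2 ^ k) - G s1) / (d / 2 ^ k)) \<longlonglongrightarrow> 0"
    by (rule filterlim_compose)
  \<comment> \<open>Multiplying by \<open>d\<close> removes its sign, which depends on the side of
    \<open>s1\<close> on which \<open>s0\<close> lies.\<close>
  from tendsto_mult_left[OF this, of d]
  have "(\<lambda>k. (G (s1 + d / 2 ^ k) - G s1) * 2 ^ k) \<longlonglongrightarrow> 0" using ne by (simp add: d_def)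
  then have "0 \<le> G s0 - G s1"
    by (rule LIMSEQ_le_const2) (use halving in \<open>auto simp: pos_le_divide_eq\<close>)
  then show False using lt by simp
qed

text \<open>The first conjunct ensures that the \<open>THE\<close> in \<open>q_hat\<close> denotes
  the solution; for \<open>t_tilde\<close> the corresponding uniqueness is shown within the
  proof.\<close>

theorem proposition6p4:
  fixes \<beta> :: real
  assumes "\<beta> > \<gamma>\<^sub>0"
  shows "(\<exists>!q. solves_q_hat \<beta> q) \<and>
    t_tilde \<beta> = pressure (- q_hat \<beta>) / \<beta> - q_hat \<beta> \<and>
    pressure (- q_hat \<beta>) / \<beta> - q_hat \<beta> = 1 / \<beta> * (INF q\<in>{..< -1/2}. pressure (- q) - q * \<beta>)"
proof -
  have \<beta>: "0 < \<beta>" using assms \<gamma>\<^sub>0_pos by simp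
  obtain s0 where s0: "1/2 < s0" "\<And>s. 1/2 < s \<Longrightarrow> pressure s0 + s0 * \<beta> \<le> pressure s + s * \<beta>"
    using pressure_tilted_minimum[OF assms] by metis
  have crit: "(pressure has_real_derivative - \<beta>) (at s0)"
  proof -
    obtain d where d: "(pressure has_real_derivative d) (at s0)"
      using pressure_differentiable[OF s0(1)] by metis
    have "((\<lambda>s. pressure s + s * \<beta>) has_real_derivative d + \<beta>) (at s0)"
      by (rule derivative_eq_intros d refl)+ simp
    then have "d + \<beta> = 0"
      by (rule DERIV_local_min[of _ _ _ "s0 - 1/2"]) (use s0 in \<open>auto simp: abs_less_iff\<close>)
    then have "d = - \<beta>" by simp
    then show ?thesis using d by simp
  qed
  have sol: "solves_q_hat \<beta> q \<longleftrightarrow> q = - s0" for q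
  proof -
    have "((\<lambda>q'. pressure (- q')) has_real_derivative \<beta>) (at q) \<longleftrightarrow>
        (pressure has_real_derivative - \<beta>) (at (- q))"
      using DERIV_mirror[of pressure "- \<beta>" q] by simp
    then show ?thesis unfolding solves_q_hat_def
      using crit s0 pressure_tilted_minimum_unique[OF s0, of "- q"] by auto
  qed
  then have q_hat: "q_hat \<beta> = - s0" unfolding q_hat_def by (intro the_equality) auto
  define V where "V = pressure s0 + s0 * \<beta>"
  \<comment> \<open>These are the constraints \<open>0 \<le> t \<le> 1\<close> of \<open>D0\<close>
    for \<open>t = V / \<beta>\<close>; the upper one compares the minimum with the value at
    \<open>s = 1\<close>.\<close>
  have V: "0 \<le> V" "V \<le> \<beta>"
  proof -
    have "s0 * \<gamma>\<^sub>0 \<le> s0 * \<beta>" using s0(1) assms by (intro mult_left_mono) auto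
    then show "0 \<le> V" using pressure_ge_golden[OF s0(1)] unfolding V_def by linarith
    show "V \<le> \<beta>" using s0(2)[of 1] pressure_1_le unfolding V_def by simp
  qed
  have t: "t_tilde \<beta> = V / \<beta>"
  proof -
    have deriv: "((\<lambda>q'. pressure1 t q') has_real_derivative \<beta>) (at q) \<longleftrightarrow>
        (pressure has_real_derivative - \<beta>) (at (t - q))" for t q
      using DERIV_shift[of "\<lambda>u. pressure (- u)" \<beta> q "- t"] DERIV_mirror[of pressure "- \<beta>" "q - t"]
      unfolding pressure1_def by simp
    \<comment> \<open>The derivative equation forces \<open>t - q = s0\<close>; then the first
      equation gives \<open>q = pressure s0 / \<beta>\<close>, and \<open>t = q + s0\<close> is
      \<open>V / \<beta>\<close>.\<close>
    have "(THE (t, q). (t, q) \<in> D0 \<and> pressure1 t q = q * \<beta> \<and>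
        ((\<lambda>q'. pressure1 t q') has_real_derivative \<beta>) (at q)) = (V / \<beta>, pressure s0 / \<beta>)"
    proof (rule the_equality)
      have eq: "V / \<beta> - pressure s0 / \<beta> = s0" unfolding V_def using \<beta> by (simp add: field_simps)
      have "1/2 < V / \<beta> - pressure s0 / \<beta>" unfolding eq by (rule s0(1))
      moreover have "0 \<le> V / \<beta>" "V / \<beta> \<le> 1" using V \<beta> by simp_all
      ultimately have "(V / \<beta>, pressure s0 / \<beta>) \<in> D0" unfolding D0_def by blast
      then show "case (V / \<beta>, pressure s0 / \<beta>) of (t, q) \<Rightarrow> (t, q) \<in> D0 \<and> pressure1 t q = q * \<beta> \<and>
        ((\<lambda>q'. pressure1 t q') has_real_derivative \<beta>) (at q)"
        using \<beta> crit by (simp add: deriv eq) (simp add: pressure1_def eq)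
    next
      fix p assume "case p of (t, q) \<Rightarrow> (t, q) \<in> D0 \<and> pressure1 t q = q * \<beta> \<and>
        ((\<lambda>q'. pressure1 t q') has_real_derivative \<beta>) (at q)"
      then obtain t q where p: "p = (t, q)" "(t, q) \<in> D0" "pressure (t - q) = q * \<beta>"
        "(pressure has_real_derivative - \<beta>) (at (t - q))"
        by (auto simp: deriv) (auto simp: pressure1_def)
      have "t - q = s0"
        by (rule pressure_tilted_minimum_unique[OF s0 _ p(4)]) (use p(2) in \<open>auto simp: D0_def\<close>)
      then show "p = (V / \<beta>, pressure s0 / \<beta>)"
        using p(1,3) \<beta> unfolding V_def by (auto simp: field_simps)
    qed
    then show ?thesis unfolding t_tilde_def by simp
  qed
  have "(INF q\<in>{..< -1/2}. pressure (- q) - q * \<beta>) = V"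
  proof (rule cInf_eq_minimum)
    show "V \<in> (\<lambda>q. pressure (- q) - q * \<beta>) ` {..< -1/2}"
      unfolding V_def by (rule image_eqI[of _ _ "- s0"]) (use s0(1) in auto)
    fix z assume "z \<in> (\<lambda>q. pressure (- q) - q * \<beta>) ` {..< -1/2}"
    then obtain q where "q < -1/2" "z = pressure (- q) - q * \<beta>" by auto
    then show "V \<le> z" using s0(2)[of "- q"] unfolding V_def by simp
  qed
  moreover have "pressure (- q_hat \<beta>) / \<beta> - q_hat \<beta> = V / \<beta>"
    unfolding q_hat V_def using \<beta> by (simp add: field_simps)
  ultimately show ?thesis using sol t by simp
qed

end
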